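(* Let $f$ be any statistic of degree $m$ and let $r$ be a positive integer. Then there exist integer constants $I, J$ with $-I\ge -\frac{rm}{2}$ and $J\le mr$, and rational constants $\alpha_i$ ($-I\le i\le J$), such that for all $n\ge I$, $$M(f^r,n)=\sum_{-I\le i\le J}\alpha_i\,(n+i)!.$$
   Context: $S_n$ is the set of permutations of $[n]=\{1,\dots,n\}$ in one-line notation. For a permutation $\pi$, $A(\pi)=\{(u,v): u=\pi_i,\ v=\pi_j,\ i<j\}$. A pattern (bivincular pattern) of length $k$ is a triple $\underline P=(P,\boldsymbol C(\underline P),\boldsymbol D(\underline P))$ where $P=p_1\cdots p_k\in S_k$ and $\boldsymbol C(\underline P),\boldsymbol D(\underline P)\subseteq[k-1]$. An occurrence of $\underline P$ in $\sigma\in S_n$, written $s\in_{\underline P}\sigma$, is a tuple $s=(t_1,\dots,t_k)\in[n]^k$ such that: (a) $t_1<\dots<t_k$; (b) $(t_i,t_j)\in A(\sigma)$ if and only if $(i,j)\in A(P)$; (c) if $i\in\boldsymbol C(\underline P)$ then $\sigma^{-1}(t_{p_{i+1}})=\sigma^{-1}(t_{p_i})+1$; (d) if $i\in\boldsymbol D(\underline P)$ then $t_{i+1}=t_i+1$. A simple statistic is given by a pattern $\underline P$ of length $k$ and a valuation function $Q(s,w)=Q_1(s)Q_2(w)$ with polynomials $Q_1,Q_2\in\mathbb Z[y_1,\dots,y_k,m]$. It is the function on $\bigcup_n S_n$ defined for $\sigma\in S_n$ by $f_{\underline P,Q}(\sigma)=\sum_{s\in_{\underline P}\sigma}Q_1(s)\,Q_2(\sigma^{-1}(s))$,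 where $Q_1(s)$ is $Q_1$ evaluated at $y_i=t_i$, $m=n$, and $Q_2(\sigma^{-1}(s))$ is $Q_2$ evaluated at $y_i=\sigma^{-1}(t_i)$, $m=n$. The degree of the simple statistic is $2k+\deg Q_1+\deg Q_2$. A statistic is a finite $\mathbb Q$-linear combination of simple statistics; its degree is the minimum, over all such representations, of the maximum degree of the simple statistics appearing. For a function $g$ on $\bigcup_n S_n$, $M(g,n)=\sum_{\sigma\in S_n}g(\sigma)$; $f^r$ is the pointwise $r$-th power. *)

theory Defs
  imports "HOL-Combinatorics.Permutations" "HOL-Library.Poly_Mapping" "HOL-Library.FuncSet" HOL.Rat
begin

text \<open>
  An element of \<open>S\<^sub>n\<close> is a function \<open>\<sigma> :: nat \<Rightarrow> nat\<close> with \<open>\<sigma> permutes {1..n}\<close>, whose one-line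
  notation is \<open>\<sigma> 1, \<dots>, \<sigma> n\<close>. Such a function does not determine \<open>n\<close>, so a function on the
  (disjoint) union of all \<open>S\<^sub>n\<close> takes \<open>n\<close> as an additional argument; its values at \<open>(n, \<sigma>)\<close> with
  \<open>\<sigma>\<close> not a permutation of \<open>{1..n}\<close> are irrelevant.
\<close>

type_synonym perm_fun = "nat \<Rightarrow> (nat \<Rightarrow> nat) \<Rightarrow> rat"

definition prec_pairs :: "nat \<Rightarrow> (nat \<Rightarrow> nat) \<Rightarrow> (nat \<times> nat) set" where
  "prec_pairs n \<pi> = {(\<pi> i, \<pi> j) | i j. i \<in> {1..n} \<and> j \<in> {1..n} \<and> i < j}"

record pattern =
  pat_len :: nat
  pat_perm :: "nat \<Rightarrow> nat"
  pat_C :: "nat set"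
  pat_D :: "nat set"

definition is_pattern :: "pattern \<Rightarrow> bool" where
  "is_pattern P \<longleftrightarrow>
     pat_perm P permutes {1..pat_len P} \<and>
     pat_C P \<subseteq> {1..<pat_len P} \<and>
     pat_D P \<subseteq> {1..<pat_len P}"

text \<open>Tuples in \<open>[n]\<^sup>k\<close> are extensional functions, so that there are finitely many of them.\<close>

definition occurrences :: "pattern \<Rightarrow> nat \<Rightarrow> (nat \<Rightarrow> nat) \<Rightarrow> (nat \<Rightarrow> nat) set" where
  "occurrences P n \<sigma> = {t \<in> {1..pat_len P} \<rightarrow>\<^sub>E {1..n}.
     (\<forall>i\<in>{1..pat_len P}. \<forall>j\<in>{1..pat_len P}. i < j \<longrightarrow> t i < t j) \<and>
     (\<forall>i\<in>{1..pat_len P}. \<forall>j\<in>{1..pat_len P}.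
        (t i, t j) \<in> prec_pairs n \<sigma> \<longleftrightarrow> (i, j) \<in> prec_pairs (pat_len P) (pat_perm P)) \<and>
     (\<forall>i\<in>pat_C P. inv \<sigma> (t (pat_perm P (i + 1))) = inv \<sigma> (t (pat_perm P i)) + 1) \<and>
     (\<forall>i\<in>pat_D P. t (i + 1) = t i + 1)}"

text \<open>
  Integer polynomials in the variables \<open>y\<^sub>1, y\<^sub>2, \<dots>\<close> and \<open>m\<close>, as finitely supported maps from
  monomials (exponent vectors) to coefficients. Index \<open>i \<ge> 1\<close> stands for \<open>y\<^sub>i\<close> and index \<open>0\<close>
  for \<open>m\<close>. The degree is the total degree in all variables, including \<open>m\<close>; the zero polynomial
  has degree \<open>0\<close>.
\<close>

type_synonym int_mpoly = "(nat \<Rightarrow>\<^sub>0 nat) \<Rightarrow>\<^sub>0 int"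

definition mpoly_vars :: "int_mpoly \<Rightarrow> nat set" where
  "mpoly_vars Q = (\<Union>\<mu>\<in>Poly_Mapping.keys Q. Poly_Mapping.keys \<mu>)"

definition mpoly_degree :: "int_mpoly \<Rightarrow> nat" where
  "mpoly_degree Q =
     Max (insert 0 ((\<lambda>\<mu>. \<Sum>i\<in>Poly_Mapping.keys \<mu>. Poly_Mapping.lookup \<mu> i) ` Poly_Mapping.keys Q))"

definition mpoly_eval :: "int_mpoly \<Rightarrow> (nat \<Rightarrow> int) \<Rightarrow> int" where
  "mpoly_eval Q x =
     (\<Sum>\<mu>\<in>Poly_Mapping.keys Q. Poly_Mapping.lookup Q \<mu> *
        (\<Prod>i\<in>Poly_Mapping.keys \<mu>. x i ^ Poly_Mapping.lookup \<mu> i))"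

text \<open>Evaluation at \<open>y\<^sub>i = t i\<close> and \<open>m = n\<close>.\<close>

definition eval_at :: "int_mpoly \<Rightarrow> nat \<Rightarrow> (nat \<Rightarrow> nat) \<Rightarrow> int" where
  "eval_at Q n t = mpoly_eval Q (\<lambda>i. if i = 0 then int n else int (t i))"

record simple_stat =
  st_pat :: pattern
  st_Q1 :: int_mpoly
  st_Q2 :: int_mpoly

definition is_simple_stat :: "simple_stat \<Rightarrow> bool" where
  "is_simple_stat S \<longleftrightarrow>
     is_pattern (st_pat S) \<and>
     mpoly_vars (st_Q1 S) \<subseteq> {0..pat_len (st_pat S)} \<and>
     mpoly_vars (st_Q2 S) \<subseteq> {0..pat_len (st_pat S)}"

definition simple_stat_fun :: "simple_stat \<Rightarrow> nat \<Rightarrow> (nat \<Rightarrow> nat) \<Rightarrow> int" where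
  "simple_stat_fun S n \<sigma> =
     (\<Sum>t\<in>occurrences (st_pat S) n \<sigma>.
        eval_at (st_Q1 S) n t * eval_at (st_Q2 S) n (\<lambda>i. inv \<sigma> (t i)))"

definition simple_stat_degree :: "simple_stat \<Rightarrow> nat" where
  "simple_stat_degree S =
     2 * pat_len (st_pat S) + mpoly_degree (st_Q1 S) + mpoly_degree (st_Q2 S)"

text \<open>
  A rational linear combination is a list of coefficients and simple statistics. Requiring it to be
  nonempty makes its maximal degree meaningful and excludes no function, since coefficients and
  polynomials may be zero.
\<close>

definition represents :: "(rat \<times> simple_stat) list \<Rightarrow> perm_fun \<Rightarrow> bool" where
  "represents L f \<longleftrightarrow>
     L \<noteq> [] \<and> (\<forall>(c, S)\<in>set L. is_simple_stat S) \<and>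
     (\<forall>n \<sigma>. \<sigma> permutes {1..n} \<longrightarrow>
        f n \<sigma> = (\<Sum>(c, S)\<leftarrow>L. c * of_int (simple_stat_fun S n \<sigma>)))"

definition is_statistic :: "perm_fun \<Rightarrow> bool" where
  "is_statistic f \<longleftrightarrow> (\<exists>L. represents L f)"

definition statistic_degree :: "perm_fun \<Rightarrow> nat" where
  "statistic_degree f =
     (LEAST d. \<exists>L. represents L f \<and> d = Max ((\<lambda>(c, S). simple_stat_degree S) ` set L))"

definition aggregate :: "perm_fun \<Rightarrow> nat \<Rightarrow> rat" where
  "aggregate g n = (\<Sum>\<sigma> | \<sigma> permutes {1..n}. g n \<sigma>)"

end

theory Submission
  imports Defs "HOL-Computational_Algebra.Polynomial"
begin

text \<open>
  A simple statistic is a sum over \<^emph>\<open>all\<close> tuples \<open>t : {1..k} \<rightarrow> {1..n}\<close>, repetitions allowed, of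
  products \<open>A n t * B n (\<sigma>\<^sup>-\<^sup>1 \<circ> t)\<close>, and \<open>f\<close> is a finite sum of such tuple sums: the
  conditions on the values of a pattern occurrence become an indicator factor of \<open>A\<close>, those on the
  positions an indicator factor of \<open>B\<close>.
  Both factors are piecewise polynomial. Which polynomial applies depends only on the gap class of
  the tuple, that is, on the differences of its entries truncated at \<open>2\<close>; these decide which entries
  are equal, which are smaller, and which are consecutive. Functions of this shape (\<open>decoupled\<close>) are
  closed under products without any analysis of how two occurrences overlap: the product of a sum
  over \<open>k\<close>-tuples and a sum over \<open>l\<close>-tuples is a sum over the concatenated \<open>(k + l)\<close>-tuples, and
  the degrees add. Hence \<open>f ^ r\<close> is decoupled of degree \<open>m * r\<close>.

  Summing over \<open>\<sigma>\<close> separates the two factors. Writing \<open>\<tau> = \<sigma>\<^sup>-\<^sup>1\<close>, the number of \<open>\<tau>\<close> with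
  \<open>\<tau> \<circ> t = w\<close> is \<open>(n - b)!\<close> if \<open>t\<close> and \<open>w\<close> have the same coincidences among their entries, where
  \<open>b \<le> k\<close> is the number of distinct entries, and \<open>0\<close> otherwise
  (\<open>card_permutations_moving_tuple\<close>). So the aggregate is a finite sum, over pairs of gap classes
  with the same coincidences, of \<open>(\<Sum>A) * (\<Sum>B) * (n - b)!\<close>, the two sums running over one gap
  class each. Such a sum over one gap class is a polynomial in \<open>n\<close> for \<open>n \<ge> k\<close>, of degree at most
  \<open>k\<close> plus the degree of the summand (\<open>sum_gap_class_piecewise_poly\<close>); this is proved by removing
  the entries with the largest value. Finally, a polynomial of degree \<open>D\<close> times \<open>(n - b)!\<close> is a
  combination of \<open>(n - b)!, \<dots>, (n - b + D)!\<close>, by expanding it in rising factorials of \<open>n - b + 1\<close>.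

  The bounds come out as follows. The degree \<open>2 * k + d + d'\<close> of a tuple sum is at most the total
  degree \<open>m * r\<close>. Therefore \<open>b \<le> k \<le> m * r / 2\<close>, which gives the lower bound on the shifts and the
  threshold for \<open>n\<close>, and the polynomial has degree at most \<open>2 * k + d + d' \<le> m * r\<close>, which gives
  the upper bound.
\<close>

section \<open>Rising factorials and polynomial summation\<close>

text \<open>
  Newton interpolation. Dividing \<open>p\<close> by \<open>X + a\<close> leaves the remainder \<open>p(-a)\<close>, and expanding the
  quotient at the base point \<open>a + 1\<close> is what is needed because
  \<open>(x + a) * pochhammer (x + a + 1) j = pochhammer (x + a) (j + 1)\<close>.
\<close>

lemma poly_pochhammer_expansion:
  fixes p :: "rat poly"
  assumes "degree p \<le> d"
  shows "\<exists>b. \<forall>x. poly p x = (\<Sum>j\<le>d. b j * pochhammer (x + a) j)"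
  using assms
proof (induction d arbitrary: p a)
  case 0
  then obtain c where "p = [:c:]"
    using degree_eq_zeroE by blast
  then show ?case
    by (intro exI[of _ "\<lambda>_. c"]) simp
next
  case (Suc d)
  define q where "q = synthetic_div p (- a)"
  have p: "p = [:a, 1:] * q + [:poly p (- a):]"
    using synthetic_div_correct'[of "- a" p] by (simp add: q_def)
  have "degree q \<le> d"
    using Suc.prems by (simp add: q_def degree_synthetic_div)
  from Suc.IH[OF this, of "a + 1"] obtain b
    where b: "\<And>x. poly q x = (\<Sum>j\<le>d. b j * pochhammer (x + (a + 1)) j)"
    by blast
  define b' where "b' j = (case j of 0 \<Rightarrow> poly p (- a) | Suc i \<Rightarrow> b i)" for j
  have "poly p x = (\<Sum>j\<le>Suc d. b' j * pochhammer (x + a) j)" for x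
  proof -
    have "poly p x = (x + a) * poly q x + poly p (- a)"
      by (subst p) (simp add: algebra_simps)
    also have "\<dots> = (\<Sum>j\<le>Suc d. b' j * pochhammer (x + a) j)"
      by (subst sum.atMost_Suc_shift)
         (simp add: b b'_def sum_distrib_left pochhammer_rec add_ac mult_ac)
    finally show ?thesis .
  qed
  then show ?case by blast
qed

text \<open>
  The sum telescopes:
  \<open>pochhammer v (j + 1) - pochhammer (v - 1) (j + 1) = (j + 1) * pochhammer v j\<close>.
\<close>

lemma sum_pochhammer:
  "(\<Sum>v=1..N. pochhammer (of_nat v :: rat) j) = pochhammer (of_nat N) (Suc j) / of_nat (Suc j)"
proof (induction N)
  case 0
  show ?case by (simp add: pochhammer_rec)
next
  case (Suc N)
  have 1: "pochhammer (of_nat N :: rat) (Suc j) = of_nat N * pochhammer (of_nat (Suc N)) j"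
    by (simp add: pochhammer_rec add_ac)
  have 2: "pochhammer (of_nat (Suc N) :: rat) (Suc j)
      = pochhammer (of_nat (Suc N)) j * (of_nat (Suc N) + of_nat j)"
    by (simp add: pochhammer_Suc)
  have "(\<Sum>v=1..Suc N. pochhammer (of_nat v :: rat) j)
      = of_nat N * pochhammer (of_nat (Suc N)) j / of_nat (Suc j) + pochhammer (of_nat (Suc N)) j"
    using Suc 1 by simp
  also have "\<dots> = pochhammer (of_nat (Suc N)) j * (of_nat (Suc N) + of_nat j) / of_nat (Suc j)"
    by (simp add: field_simps del: of_nat_Suc) (simp add: algebra_simps)
  finally show ?case using 2 by simp
qed

lemma degree_pochhammer_X: "degree (pochhammer [:0, 1::rat:] j) \<le> j"
proof (induction j)
  case (Suc j)
  have "pochhammer [:0, 1::rat:] (Suc j) = pochhammer [:0, 1:] j * [:of_nat j, 1:]"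
    by (simp add: pochhammer_Suc of_nat_poly)
  then show ?case
    using Suc degree_mult_le[of "pochhammer [:0, 1::rat:] j" "[:of_nat j, 1:]"] by simp
qed simp

lemma poly_pochhammer_X: "poly (pochhammer [:0, 1::rat:] j) x = pochhammer x j"
  by (induction j) (simp_all add: pochhammer_Suc of_nat_poly algebra_simps)

lemma poly_indefinite_sum:
  fixes p :: "rat poly"
  assumes "degree p \<le> d"
  shows "\<exists>q. degree q \<le> Suc d \<and> (\<forall>N. (\<Sum>v=1..N. poly p (of_nat v)) = poly q (of_nat N))"
proof -
  from poly_pochhammer_expansion[OF assms, of 0] obtain b
    where b: "\<And>x. poly p x = (\<Sum>j\<le>d. b j * pochhammer x j)" by auto
  define q where "q = (\<Sum>j\<le>d. smult (b j / of_nat (Suc j)) (pochhammer [:0, 1::rat:] (Suc j)))"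
  have "degree q \<le> Suc d"
    unfolding q_def
  proof (rule degree_sum_le)
    fix j assume "j \<in> {..d}"
    then have "degree (pochhammer [:0, 1::rat:] (Suc j)) \<le> Suc d"
      using degree_pochhammer_X[of "Suc j"] by simp
    then show "degree (smult (b j / of_nat (Suc j)) (pochhammer [:0, 1::rat:] (Suc j))) \<le> Suc d"
      using degree_smult_le order_trans by blast
  qed simp
  moreover have "(\<Sum>v=1..N. poly p (of_nat v)) = poly q (of_nat N)" for N
  proof -
    have "(\<Sum>v=1..N. poly p (of_nat v))
        = (\<Sum>j\<le>d. b j * (\<Sum>v=1..N. pochhammer (of_nat v) j))"
      unfolding b sum_distrib_left by (rule sum.swap)
    also have "\<dots> = poly q (of_nat N)"
      unfolding sum_pochhammer q_def poly_sum
      by (intro sum.cong) (simp_all add: poly_pochhammer_X)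
    finally show ?thesis .
  qed
  ultimately show ?thesis by blast
qed

section \<open>Combinations of shifted factorials\<close>

text \<open>
  The threshold and the range of shifts depend on \<open>m\<close> alone, so that combinations for the same \<open>m\<close>
  can be added term by term. From the threshold on, \<open>n + i \<ge> 0\<close> for every shift \<open>i\<close> that occurs, and
  \<open>nat\<close> truncates nothing.
\<close>

definition factorial_comb :: "nat \<Rightarrow> (nat \<Rightarrow> rat) \<Rightarrow> bool" where
  "factorial_comb m a \<longleftrightarrow>
     (\<exists>\<alpha>. \<forall>n \<ge> m div 2. a n = (\<Sum>i\<in>{- int (m div 2)..int m}. \<alpha> i * fact (nat (int n + i))))"

lemma factorial_comb_cong:
  assumes "factorial_comb m a" "\<And>n. n \<ge> m div 2 \<Longrightarrow> b n = a n"
  shows "factorial_comb m b"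
  using assms unfolding factorial_comb_def by simp

lemma factorial_comb_0: "factorial_comb m (\<lambda>n. 0)"
  unfolding factorial_comb_def by (intro exI[of _ "\<lambda>_. 0"]) simp

lemma factorial_comb_add:
  assumes "factorial_comb m a" "factorial_comb m b"
  shows "factorial_comb m (\<lambda>n. a n + b n)"
proof -
  from assms obtain \<alpha> \<beta> where
    "\<forall>n \<ge> m div 2. a n = (\<Sum>i\<in>{- int (m div 2)..int m}. \<alpha> i * fact (nat (int n + i)))"
    "\<forall>n \<ge> m div 2. b n = (\<Sum>i\<in>{- int (m div 2)..int m}. \<beta> i * fact (nat (int n + i)))"
    unfolding factorial_comb_def by blast
  then show ?thesis
    unfolding factorial_comb_def
    by (intro exI[of _ "\<lambda>i. \<alpha> i + \<beta> i"]) (simp add: sum.distrib distrib_right)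
qed

lemma factorial_comb_sum:
  assumes "finite X" "\<And>x. x \<in> X \<Longrightarrow> factorial_comb m (a x)"
  shows "factorial_comb m (\<lambda>n. \<Sum>x\<in>X. a x n)"
  using assms by (induction X rule: finite_induct) (auto intro: factorial_comb_0 factorial_comb_add)

lemma pochhammer_times_fact: "pochhammer (of_nat N + 1) j * fact N = (fact (N + j) :: rat)"
proof (induction j)
  case (Suc j)
  have "pochhammer (of_nat N + 1) (Suc j) * fact N
      = (pochhammer (of_nat N + 1) j * fact N) * (of_nat N + 1 + of_nat j :: rat)"
    by (simp add: pochhammer_Suc mult_ac)
  also have "\<dots> = fact (N + Suc j)"
    unfolding Suc by (simp add: algebra_simps)
  finally show ?case .
qed simp

text \<open>
  Rising factorials of \<open>n - b + 1\<close> are the right basis because multiplying them by \<open>(n - b)!\<close> gives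
  factorials again: \<open>(n - b + 1) \<cdots> (n - b + j) * (n - b)! = (n - b + j)!\<close>. The shifts \<open>j - b\<close> run
  from \<open>- b\<close> to \<open>degree p - b\<close>.
\<close>

lemma factorial_comb_poly_times_fact:
  fixes p :: "rat poly"
  assumes "degree p \<le> m" "b \<le> m div 2"
  shows "factorial_comb m (\<lambda>n. poly p (of_nat n) * fact (n - b))"
proof -
  from poly_pochhammer_expansion[OF order_refl, of p "1 - of_nat b"] obtain c where
    c: "\<And>x. poly p x = (\<Sum>j\<le>degree p. c j * pochhammer (x + (1 - of_nat b)) j)" by blast
  define J where "J = (\<lambda>j. int j - int b) ` {..degree p}"
  define \<alpha> where "\<alpha> i = (if i \<in> J then c (nat (i + int b)) else 0)" for i
  have inj: "inj_on (\<lambda>j. int j - int b) {..degree p}"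
    by (auto simp: inj_on_def)
  have J: "J \<subseteq> {- int (m div 2)..int m}"
    using assms by (auto simp: J_def)
  have "poly p (of_nat n) * fact (n - b)
      = (\<Sum>i\<in>{- int (m div 2)..int m}. \<alpha> i * fact (nat (int n + i)))" if "m div 2 \<le> n" for n
  proof -
    have n: "b \<le> n" using that assms(2) by simp
    then have base: "(of_nat n + (1 - of_nat b) :: rat) = of_nat (n - b) + 1"
      by (simp add: of_nat_diff)
    have "poly p (of_nat n) * fact (n - b) = (\<Sum>j\<le>degree p. c j * fact (n - b + j))"
      unfolding c base sum_distrib_right mult.assoc pochhammer_times_fact ..
    also have "\<dots> = (\<Sum>j\<le>degree p. \<alpha> (int j - int b) * fact (nat (int n + (int j - int b))))"
    proof (intro sum.cong refl)
      fix j assume "j \<in> {..degree p}"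
      then have "\<alpha> (int j - int b) = c j"
        by (auto simp: \<alpha>_def J_def)
      moreover have "nat (int n + (int j - int b)) = n - b + j"
        using n by simp
      ultimately show "c j * fact (n - b + j)
          = \<alpha> (int j - int b) * fact (nat (int n + (int j - int b)))"
        by simp
    qed
    also have "\<dots> = (\<Sum>i\<in>J. \<alpha> i * fact (nat (int n + i)))"
      unfolding J_def by (simp add: sum.reindex[OF inj])
    also have "\<dots> = (\<Sum>i\<in>{- int (m div 2)..int m}. \<alpha> i * fact (nat (int n + i)))"
      by (rule sum.mono_neutral_left) (use J in \<open>auto simp: \<alpha>_def\<close>)
    finally show ?thesis .
  qed
  then show ?thesis
    unfolding factorial_comb_def by blast
qed

section \<open>Gap classes of tuples\<close>

text \<open>
  The conditions of a bivincular pattern compare two entries or ask whether they are consecutive.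
  The differences truncated to \<open>{0, 1, 2}\<close> carry exactly this information; as subtraction on naturals
  also truncates at \<open>0\<close>, the order of \<open>t i\<close> and \<open>t j\<close> can be read off as well. Comparing with a
  reference tuple \<open>t0\<close>, instead of with an abstract table of gaps, excludes inconsistent tables, and
  the order of the entries is available as the order of the values of \<open>t0\<close>.
\<close>

definition same_gaps :: "nat set \<Rightarrow> (nat \<Rightarrow> nat) \<Rightarrow> (nat \<Rightarrow> nat) \<Rightarrow> bool" where
  "same_gaps K t0 t \<longleftrightarrow> (\<forall>i\<in>K. \<forall>j\<in>K. min 2 (t j - t i) = min 2 (t0 j - t0 i))"

lemma same_gapsD:
  assumes "same_gaps K t0 t" "i \<in> K" "j \<in> K"
  shows "t i < t j \<longleftrightarrow> t0 i < t0 j" "t i = t j \<longleftrightarrow> t0 i = t0 j" "t j = t i + 1 \<longleftrightarrow> t0 j = t0 i + 1"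
proof -
  have *: "min 2 (t j - t i) = min 2 (t0 j - t0 i)" "min 2 (t i - t j) = min 2 (t0 i - t0 j)"
    using assms by (auto simp: same_gaps_def)
  show "t i < t j \<longleftrightarrow> t0 i < t0 j" using *(1) by linarith
  show "t i = t j \<longleftrightarrow> t0 i = t0 j" using * by linarith
  show "t j = t i + 1 \<longleftrightarrow> t0 j = t0 i + 1" using * by linarith
qed

lemma same_gaps_mono: "same_gaps K t0 t \<Longrightarrow> K' \<subseteq> K \<Longrightarrow> same_gaps K' t0 t"
  by (auto simp: same_gaps_def)

lemma same_gaps_refl: "same_gaps K t t"
  by (auto simp: same_gaps_def)

definition gap_class :: "nat set \<Rightarrow> (nat \<Rightarrow> nat) \<Rightarrow> nat \<Rightarrow> (nat \<Rightarrow> nat) set" where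
  "gap_class K t0 N = {t \<in> K \<rightarrow>\<^sub>E {1..N}. same_gaps K t0 t}"

lemma finite_gap_class: "finite K \<Longrightarrow> finite (gap_class K t0 N)"
  by (simp add: gap_class_def finite_PiE)

text \<open>
  The positions \<open>B\<close> of the largest entry are the same for all tuples of a gap class. A tuple is given
  by its largest value \<open>v\<close>, which contributes the power \<open>v ^ sum e B\<close>, and by its remaining entries;
  these lie below \<open>v\<close>, form a tuple with the gaps of \<open>t0\<close>, and have prescribed truncated distances to
  \<open>v\<close>.
\<close>

lemma sum_gap_class_monomial_peel:
  fixes t0 e :: "nat \<Rightarrow> nat"
  assumes K: "finite K" and "K \<noteq> {}"
  defines "M \<equiv> Max (t0 ` K)"
  defines "B \<equiv> {i \<in> K. t0 i = M}"
  defines "rest \<equiv> \<lambda>v. {t \<in> gap_class (K - B) t0 (v - 1). \<forall>i\<in>K - B. min 2 (v - t i) = min 2 (M - t0 i)}"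
  shows "(\<Sum>t\<in>gap_class K t0 N. \<Prod>i\<in>K. of_nat (t i) ^ e i)
    = (\<Sum>v=1..N. of_nat v ^ sum e B * (\<Sum>t\<in>rest v. \<Prod>i\<in>K - B. of_nat (t i) ^ e i) :: rat)"
proof -
  have "M \<in> t0 ` K"
    unfolding M_def using assms(1,2) by (intro Max_in) auto
  then obtain b where b: "b \<in> B" by (auto simp: B_def)
  have BK: "B \<subseteq> K" by (auto simp: B_def)
  have le: "t0 i \<le> M" if "i \<in> K" for i
    using that K by (auto simp: M_def)
  have lt: "t0 i < M" if "i \<in> K - B" for i
    using that le[of i] by (auto simp: B_def)
  \<comment> \<open>The tuple with value \<open>v\<close> on \<open>B\<close> and entries \<open>t\<close> elsewhere; its inverse reads \<open>v\<close> off at \<open>b \<in> B\<close>.\<close>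
  define join where "join = (\<lambda>(v, t) i. if i \<in> B then v else (t i :: nat))"
  have "(\<Sum>v=1..N. of_nat v ^ sum e B * (\<Sum>t\<in>rest v. \<Prod>i\<in>K - B. of_nat (t i) ^ e i) :: rat)
      = (\<Sum>(v, t)\<in>Sigma {1..N} rest. of_nat v ^ sum e B * (\<Prod>i\<in>K - B. of_nat (t i) ^ e i))"
    unfolding sum_distrib_left
    by (subst sum.Sigma) (auto simp: rest_def finite_gap_class K)
  also have "\<dots> = (\<Sum>t\<in>gap_class K t0 N. \<Prod>i\<in>K. of_nat (t i) ^ e i)"
  proof (rule sum.reindex_bij_witness[where i = "\<lambda>t. (t b, restrict t (K - B))" and j = join])
    fix a assume a: "a \<in> Sigma {1..N} rest"
    obtain v t where vt: "a = (v, t)" by (cases a)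
    then have v: "v \<in> {1..N}" and t: "t \<in> K - B \<rightarrow>\<^sub>E {1..v - 1}" "same_gaps (K - B) t0 t"
      and gap: "\<And>i. i \<in> K - B \<Longrightarrow> min 2 (v - t i) = min 2 (M - t0 i)"
      using a by (auto simp: rest_def gap_class_def)
    show "(join a b, restrict (join a) (K - B)) = a"
      using b t(1) by (auto simp: vt join_def PiE_def extensional_def fun_eq_iff)
    have tv: "t i \<in> {1..v - 1}" if "i \<in> K - B" for i
      using t(1) that by blast
    have "join a \<in> K \<rightarrow>\<^sub>E {1..N}"
    proof
      fix i assume "i \<in> K"
      then show "join a i \<in> {1..N}" using v tv[of i] by (auto simp: vt join_def)
    next
      fix i assume "i \<notin> K"
      then show "join a i = undefined" using t(1) BK by (auto simp: vt join_def PiE_def extensional_def)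
    qed
    moreover have "same_gaps K t0 (join a)"
      unfolding same_gaps_def
    proof (intro ballI)
      fix i j assume ij: "i \<in> K" "j \<in> K"
      consider "i \<in> B" "j \<in> B" | "i \<in> B" "j \<notin> B" | "i \<notin> B" "j \<in> B" | "i \<notin> B" "j \<notin> B" by blast
      then show "min 2 (join a j - join a i) = min 2 (t0 j - t0 i)"
      proof cases
        case 1
        then show ?thesis by (simp add: vt join_def B_def)
      next
        case 2
        then have "t j \<le> v" using tv[of j] ij by auto
        then show ?thesis using 2 le[of j] ij by (simp add: vt join_def B_def)
      next
        case 3
        then have "t0 j = M" by (auto simp: B_def)
        then show ?thesis using 3 gap[of i] ij by (simp add: vt join_def)
      next
        case 4
        then show ?thesis using t(2) ij by (simp add: vt join_def same_gaps_def)
      qed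
    qed
    ultimately show "join a \<in> gap_class K t0 N" by (simp add: gap_class_def)
    have "(\<Prod>i\<in>K. of_nat (join a i) ^ e i :: rat)
        = (\<Prod>i\<in>K - B. of_nat (join a i) ^ e i) * (\<Prod>i\<in>B. of_nat (join a i) ^ e i)"
      by (rule prod.subset_diff[OF BK K])
    also have "(\<Prod>i\<in>K - B. of_nat (join a i) ^ e i :: rat) = (\<Prod>i\<in>K - B. of_nat (t i) ^ e i)"
      by (intro prod.cong) (auto simp: vt join_def)
    also have "(\<Prod>i\<in>B. of_nat (join a i) ^ e i :: rat) = of_nat v ^ sum e B"
      by (simp add: vt join_def power_sum)
    finally show "(\<Prod>i\<in>K. of_nat (join a i) ^ e i)
        = (case a of (v, t) \<Rightarrow> (of_nat v ^ sum e B * (\<Prod>i\<in>K - B. of_nat (t i) ^ e i) :: rat))"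
      by (simp add: vt mult.commute)
  next
    fix t assume "t \<in> gap_class K t0 N"
    then have t: "t \<in> K \<rightarrow>\<^sub>E {1..N}" and g: "same_gaps K t0 t"
      by (auto simp: gap_class_def)
    have tB: "t i = t b" if "i \<in> B" for i
      using same_gapsD(2)[OF g, of i b] that b by (auto simp: B_def)
    have tM: "t i < t b" if "i \<in> K - B" for i
      using same_gapsD(1)[OF g, of i b] that b lt[OF that] by (auto simp: B_def)
    show "join (t b, restrict t (K - B)) = t"
      using t tB BK by (auto simp: join_def fun_eq_iff PiE_def extensional_def)
    have "restrict t (K - B) \<in> K - B \<rightarrow>\<^sub>E {1..t b - 1}"
    proof
      fix i assume i: "i \<in> K - B"
      then have "t i \<in> {1..N}" using t by blast
      then show "restrict t (K - B) i \<in> {1..t b - 1}" using tM[OF i] i by auto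
    qed (auto simp: restrict_def)
    moreover have "same_gaps (K - B) t0 (restrict t (K - B))"
      using same_gaps_mono[OF g, of "K - B"] by (auto simp: same_gaps_def)
    moreover have "min 2 (t b - t i) = min 2 (M - t0 i)" if "i \<in> K - B" for i
      using g that b by (auto simp: same_gaps_def B_def)
    moreover have "t b \<in> {1..N}" using t b BK by blast
    ultimately show "(t b, restrict t (K - B)) \<in> Sigma {1..N} rest"
      by (auto simp: rest_def gap_class_def)
  qed
  finally show ?thesis ..
qed

text \<open>
  Describes the remaining entries after the largest value \<open>v\<close> has been removed. The distance to \<open>v\<close>
  has to be checked at the largest remaining entry only: an entry strictly below that one is at
  distance at least \<open>2\<close> from \<open>v\<close> in any case. So the condition says that the maximum of the
  remaining entries is \<open>v - 1\<close>, or that it is at most \<open>v - 2\<close>.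
\<close>

lemma gap_class_below_top:
  fixes t0 :: "nat \<Rightarrow> nat"
  assumes K: "finite K" "K \<noteq> {}" and M: "Max (t0 ` K) < M"
  shows "{t \<in> gap_class K t0 (v - 1). \<forall>i\<in>K. min 2 (v - t i) = min 2 (M - t0 i)}
    = (if M = Max (t0 ` K) + 1 then gap_class K t0 (v - 1) - gap_class K t0 (v - 2)
       else gap_class K t0 (v - 2))" (is "?L = ?R")
proof -
  have "Max (t0 ` K) \<in> t0 ` K"
    using K by (intro Max_in) auto
  then obtain b where b: "b \<in> K" "t0 b = Max (t0 ` K)" by auto
  have le: "t0 i \<le> t0 b" if "i \<in> K" for i
    using that K b by auto
  have Mb: "t0 b < M" using M b by simp
  have "t \<in> ?L \<longleftrightarrow> t \<in> ?R" for t
  proof (cases "t \<in> K \<rightarrow>\<^sub>E UNIV \<and> same_gaps K t0 t \<and> (\<forall>i\<in>K. 1 \<le> t i \<and> t i < v)")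
    case False
    moreover have "t i < v" if "t i \<in> {1..v - 1} \<or> t i \<in> {1..v - 2}" for i
      using that by auto
    ultimately show ?thesis
      by (auto simp: gap_class_def PiE_def Pi_def)
  next
    case True
    then have g: "same_gaps K t0 t" and t1: "\<And>i. i \<in> K \<Longrightarrow> 1 \<le> t i" "\<And>i. i \<in> K \<Longrightarrow> t i < v"
      and ext: "t \<in> extensional K"
      by (auto simp: PiE_def)
    have tle: "t i \<le> t b" if "i \<in> K" for i
      using same_gapsD(1)[OF g b(1) that] le[OF that] by (auto simp: not_less)
    have in1: "t \<in> gap_class K t0 (v - 1)"
      using ext t1 g by (force simp: gap_class_def PiE_def Pi_def)
    have in2: "t \<in> gap_class K t0 (v - 2) \<longleftrightarrow> t b + 2 \<le> v"
    proof
      assume "t \<in> gap_class K t0 (v - 2)"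
      then have "t b \<in> {1..v - 2}" using b by (auto simp: gap_class_def)
      then show "t b + 2 \<le> v" by auto
    next
      assume "t b + 2 \<le> v"
      then have "t i \<in> {1..v - 2}" if "i \<in> K" for i
        using tle[OF that] t1[OF that] by auto
      then show "t \<in> gap_class K t0 (v - 2)"
        using ext g by (auto simp: gap_class_def PiE_def)
    qed
    have "(\<forall>i\<in>K. min 2 (v - t i) = min 2 (M - t0 i)) \<longleftrightarrow> min 2 (v - t b) = min 2 (M - t0 b)"
    proof
      assume *: "min 2 (v - t b) = min 2 (M - t0 b)"
      show "\<forall>i\<in>K. min 2 (v - t i) = min 2 (M - t0 i)"
      proof
        fix i assume i: "i \<in> K"
        show "min 2 (v - t i) = min 2 (M - t0 i)"
        proof (cases "t0 i = t0 b")
          case True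
          then show ?thesis using * same_gapsD(2)[OF g i b(1)] by simp
        next
          case False
          then have "t0 i < t0 b" "t i < t b"
            using le[OF i] same_gapsD(1)[OF g i b(1)] by auto
          then show ?thesis using Mb t1(2)[OF b(1)] by linarith
        qed
      qed
    qed (use b in blast)
    then have "t \<in> ?L \<longleftrightarrow> min 2 (v - t b) = min 2 (M - t0 b)"
      using in1 by simp
    also have "\<dots> \<longleftrightarrow> t \<in> ?R"
      using in1 in2 Mb t1(2)[OF b(1)] unfolding b(2)[symmetric] by auto
    finally show ?thesis .
  qed
  then show ?thesis by blast
qed

lemma gap_class_mono: "N \<le> N' \<Longrightarrow> gap_class K t0 N \<subseteq> gap_class K t0 N'"
  by (force simp: gap_class_def PiE_def Pi_def)

text \<open>
  By induction, the sum \<open>S (rest v)\<close> over the remaining entries is a polynomial in \<open>v\<close>, and summation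
  over \<open>v\<close> raises the degree by one, while \<open>K\<close> has lost at least one element. The threshold
  \<open>card K - 1\<close> is the one that the induction preserves: for \<open>v \<ge> card K\<close> the induction hypothesis is
  used at \<open>v - 2 \<ge> card K - 2\<close>, and \<open>K'\<close> has at most \<open>card K - 1\<close> elements. The finitely many terms
  with \<open>v < card K\<close> do not depend on \<open>N\<close>, so they change the polynomial by a constant.
\<close>

lemma sum_gap_class_monomial_poly:
  fixes t0 e :: "nat \<Rightarrow> nat"
  assumes "finite K"
  shows "\<exists>p :: rat poly. degree p \<le> card K + sum e K \<and>
    (\<forall>N \<ge> card K - 1. (\<Sum>t\<in>gap_class K t0 N. \<Prod>i\<in>K. of_nat (t i) ^ e i) = poly p (of_nat N))"
  using assms
proof (induction K rule: finite_psubset_induct)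
  case (psubset K)
  show ?case
  proof (cases "K = {}")
    case True
    then have "gap_class K t0 N = {\<lambda>_. undefined}" for N
      by (auto simp: gap_class_def same_gaps_def)
    then show ?thesis using True by (intro exI[of _ 1]) simp
  next
    case False
    define M where "M = Max (t0 ` K)"
    define B where "B = {i \<in> K. t0 i = M}"
    define K' where "K' = K - B"
    define rest where "rest v =
      {t \<in> gap_class K' t0 (v - 1). \<forall>i\<in>K'. min 2 (v - t i) = min 2 (M - t0 i)}" for v
    define S where "S X = (\<Sum>t\<in>X. \<Prod>i\<in>K'. of_nat (t i) ^ e i :: rat)" for X
    have peel: "(\<Sum>t\<in>gap_class K t0 N. \<Prod>i\<in>K. of_nat (t i) ^ e i)
        = (\<Sum>v=1..N. of_nat v ^ sum e B * S (rest v))" for N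
      unfolding S_def rest_def K'_def B_def M_def
      by (rule sum_gap_class_monomial_peel[OF psubset.hyps(1) False])
    have "M \<in> t0 ` K"
      unfolding M_def using psubset.hyps False by (intro Max_in) auto
    then have "B \<noteq> {}" "B \<subseteq> K" by (auto simp: B_def)
    then have "K' \<subset> K" and K'fin: "finite K'" using psubset.hyps by (auto simp: K'_def)
    then have card: "card K' < card K" using psubset.hyps psubset_card_mono by blast
    have sum_e: "sum e K' + sum e B = sum e K"
      unfolding K'_def using \<open>B \<subseteq> K\<close> psubset.hyps by (simp add: sum.subset_diff)
    obtain p where p: "degree p \<le> card K' + sum e K'"
        "\<And>N. N \<ge> card K' - 1 \<Longrightarrow> S (gap_class K' t0 N) = poly p (of_nat N)"
      using psubset.IH[OF \<open>K' \<subset> K\<close>] unfolding S_def by blast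
    have "\<exists>q. degree q \<le> card K' + sum e K' \<and> (\<forall>v\<ge>card K. S (rest v) = poly q (of_nat v))"
    proof (cases "K' = {}")
      case True
      have "rest v = gap_class K' t0 0" for v
        using True by (auto simp: rest_def gap_class_def same_gaps_def)
      then show ?thesis
        using True p(2)[of 0] by (intro exI[of _ "[:poly p 0:]"]) simp
    next
      case False
      have shift: "degree (pcompose p [:- c, 1:]) \<le> card K' + sum e K'" for c
        using p(1) by (simp add: degree_pcompose)
      have "card K' > 0" using False K'fin by (simp add: card_gt_0_iff)
      then have val1: "S (gap_class K' t0 (v - 1)) = poly (pcompose p [:- 1, 1:]) (of_nat v)"
        and val2: "S (gap_class K' t0 (v - 2)) = poly (pcompose p [:- 2, 1:]) (of_nat v)"
        if "v \<ge> card K" for v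
        using that card p(2)[of "v - 1"] p(2)[of "v - 2"]
        by (simp_all add: poly_pcompose of_nat_diff)
      have "Max (t0 ` K') \<in> t0 ` K'"
        using K'fin False by (intro Max_in) auto
      then obtain b where b: "b \<in> K" "b \<notin> B" "t0 b = Max (t0 ` K')" by (auto simp: K'_def)
      have "t0 b \<le> M" unfolding M_def using psubset.hyps b(1) by (intro Max_ge) auto
      then have "Max (t0 ` K') < M" using b by (auto simp: B_def)
      note rest_eq = gap_class_below_top[OF K'fin False this, folded rest_def]
      show ?thesis
      proof (cases "M = Max (t0 ` K') + 1")
        case True
        have "S (rest v) = S (gap_class K' t0 (v - 1)) - S (gap_class K' t0 (v - 2))" for v
          unfolding rest_eq S_def using True K'fin
          by (simp add: sum_diff finite_gap_class gap_class_mono)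
        then show ?thesis
          using val1 val2 shift[of 1] shift[of 2]
          by (intro exI[of _ "pcompose p [:- 1, 1:] - pcompose p [:- 2, 1:]"])
             (simp add: degree_diff_le)
      next
        case False
        then show ?thesis
          using val2 shift[of 2] rest_eq by (intro exI[of _ "pcompose p [:- 2, 1:]"]) simp
      qed
    qed
    then obtain q where q: "degree q \<le> card K' + sum e K'"
      "\<And>v. v \<ge> card K \<Longrightarrow> S (rest v) = poly q (of_nat v)" by blast
    define u where "u = monom 1 (sum e B) * q"
    have "degree u \<le> sum e B + (card K' + sum e K')"
      unfolding u_def using degree_mult_le[of "monom 1 (sum e B)" q] q(1)
        degree_monom_le[of "1::rat" "sum e B"] by linarith
    from poly_indefinite_sum[OF this] obtain R where
      R: "degree R \<le> Suc (sum e B + (card K' + sum e K'))"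
         "\<And>N. (\<Sum>v=1..N. poly u (of_nat v)) = poly R (of_nat N)" by blast
    \<comment> \<open>The correction for the small \<open>v\<close>, where the summand need not agree with the polynomial \<open>u\<close>.\<close>
    define c where "c = (\<Sum>v=1..card K - 1. of_nat v ^ sum e B * S (rest v))
      - (\<Sum>v=1..card K - 1. poly u (of_nat v))"
    have "degree (R + [:c:]) \<le> card K + sum e K"
      using R(1) card sum_e by (intro degree_add_le) auto
    moreover have "(\<Sum>t\<in>gap_class K t0 N. \<Prod>i\<in>K. of_nat (t i) ^ e i)
        = poly (R + [:c:]) (of_nat N)" if N: "N \<ge> card K - 1" for N
    proof -
      have split: "{1..N} = {1..card K - 1} \<union> {card K..N}"
        using N card by auto
      have sum_split: "sum h {1..N} = sum h {1..card K - 1} + sum h {card K..N}" for h :: "nat \<Rightarrow> rat"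
        unfolding split using card by (intro sum.union_disjoint) auto
      have "(\<Sum>v=card K..N. of_nat v ^ sum e B * S (rest v)) = (\<Sum>v=card K..N. poly u (of_nat v))"
        by (intro sum.cong) (auto simp: u_def poly_monom q(2))
      then have "(\<Sum>v=1..N. of_nat v ^ sum e B * S (rest v)) = (\<Sum>v=1..N. poly u (of_nat v)) + c"
        unfolding sum_split c_def by simp
      then show ?thesis
        unfolding peel using R(2) by simp
    qed
    ultimately show ?thesis by blast
  qed
qed

section \<open>Piecewise polynomial functions of tuples\<close>

text \<open>
  Polynomials in \<open>n\<close> and the entries \<open>t i\<close>, \<open>i \<in> K\<close>, of total degree at most \<open>d\<close>, as the span of the
  monomials.
\<close>

inductive poly_fun :: "nat set \<Rightarrow> nat \<Rightarrow> (nat \<Rightarrow> (nat \<Rightarrow> nat) \<Rightarrow> rat) \<Rightarrow> bool" for K d where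
  monomial: "a + sum e K \<le> d \<Longrightarrow>
     poly_fun K d (\<lambda>n t. c * of_nat n ^ a * (\<Prod>i\<in>K. of_nat (t i) ^ e i))"
| add: "poly_fun K d q \<Longrightarrow> poly_fun K d q' \<Longrightarrow> poly_fun K d (\<lambda>n t. q n t + q' n t)"

lemma poly_fun_const: "poly_fun K d (\<lambda>n t. c)"
  using poly_fun.monomial[of 0 "\<lambda>_. 0" K d c] by simp

lemma poly_fun_sum:
  assumes "finite X" "\<And>x. x \<in> X \<Longrightarrow> poly_fun K d (q x)"
  shows "poly_fun K d (\<lambda>n t. \<Sum>x\<in>X. q x n t)"
  using assms
  by (induction X rule: finite_induct) (auto intro: poly_fun_const poly_fun.add)

lemma poly_fun_mult:
  assumes "poly_fun K d q" "poly_fun K d' q'"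
  shows "poly_fun K (d + d') (\<lambda>n t. q n t * q' n t)"
  using assms(1)
proof induction
  case (monomial a e c)
  note 1 = this
  show ?case
    using assms(2)
  proof induction
    case (monomial a' e' c')
    have "a + a' + (\<Sum>i\<in>K. e i + e' i) \<le> d + d'"
      using 1 monomial by (simp add: sum.distrib)
    from poly_fun.monomial[OF this, of "c * c'"] show ?case
      by (simp add: power_add prod.distrib mult_ac)
  next
    case (add q q')
    then show ?case using poly_fun.add[OF add.IH] by (simp add: distrib_left)
  qed
next
  case (add q1 q2)
  then show ?case using poly_fun.add[OF add.IH] by (simp add: distrib_right)
qed

lemma poly_fun_cong:
  assumes "poly_fun K d q" "\<And>i. i \<in> K \<Longrightarrow> t i = t' i"
  shows "q n t = q n t'"
  using assms by induction simp_all

lemma poly_fun_reindex: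
  assumes "poly_fun K d q" "inj_on h K" "h ` K \<subseteq> K'" "finite K'"
  shows "poly_fun K' d (\<lambda>n t. q n (\<lambda>i. t (h i)))"
  using assms(1)
proof induction
  case (monomial a e c)
  define e' where "e' j = (if j \<in> h ` K then e (inv_into K h j) else 0)" for j
  have e': "e' (h i) = e i" if "i \<in> K" for i
    using that assms(2) by (simp add: e'_def)
  have "sum e' K' = sum e' (h ` K)"
    using assms by (intro sum.mono_neutral_right) (auto simp: e'_def)
  also have "\<dots> = sum e K"
    using assms(2) e' by (simp add: sum.reindex)
  finally have "a + sum e' K' \<le> d" using monomial by simp
  moreover have "(\<Prod>j\<in>K'. of_nat (t j) ^ e' j :: rat) = (\<Prod>i\<in>K. of_nat (t (h i)) ^ e i)" for t :: "nat \<Rightarrow> nat"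
  proof -
    have "(\<Prod>j\<in>K'. of_nat (t j) ^ e' j :: rat) = (\<Prod>j\<in>h ` K. of_nat (t j) ^ e' j)"
      using assms by (intro prod.mono_neutral_right) (auto simp: e'_def)
    also have "\<dots> = (\<Prod>i\<in>K. of_nat (t (h i)) ^ e i)"
      using assms(2) e' by (simp add: prod.reindex)
    finally show ?thesis .
  qed
  ultimately show ?case
    using poly_fun.monomial[of a e' K' d c] by simp
next
  case (add q q')
  show ?case by (rule poly_fun.add[OF add.IH])
qed

text \<open>
  One polynomial for each gap class. This makes indicators of order and adjacency conditions
  functions of degree \<open>0\<close>, so that restricting a sum to the tuples that satisfy such conditions is
  multiplication by a factor.
\<close>

definition piecewise_poly :: "nat set \<Rightarrow> nat \<Rightarrow> (nat \<Rightarrow> (nat \<Rightarrow> nat) \<Rightarrow> rat) \<Rightarrow> bool" where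
  "piecewise_poly K d A \<longleftrightarrow>
     (\<forall>t0. \<exists>q. poly_fun K d q \<and> (\<forall>n t. same_gaps K t0 t \<longrightarrow> A n t = q n t))"

lemma piecewise_poly_of_poly_fun: "poly_fun K d q \<Longrightarrow> piecewise_poly K d q"
  by (auto simp: piecewise_poly_def)

lemma piecewise_poly_indicator:
  assumes "\<And>t0 t. same_gaps K t0 t \<Longrightarrow> \<Phi> t \<longleftrightarrow> \<Phi> t0"
  shows "piecewise_poly K 0 (\<lambda>n t. of_bool (\<Phi> t))"
  unfolding piecewise_poly_def
proof
  fix t0
  show "\<exists>q. poly_fun K 0 q \<and> (\<forall>n t. same_gaps K t0 t \<longrightarrow> of_bool (\<Phi> t) = q n t)"
    using assms by (intro exI[of _ "\<lambda>_ _. of_bool (\<Phi> t0)"]) (auto intro: poly_fun_const)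
qed

lemma piecewise_poly_mult:
  assumes "piecewise_poly K d A" "piecewise_poly K d' B"
  shows "piecewise_poly K (d + d') (\<lambda>n t. A n t * B n t)"
  unfolding piecewise_poly_def
proof
  fix t0
  obtain q q' where "poly_fun K d q" "\<forall>n t. same_gaps K t0 t \<longrightarrow> A n t = q n t"
    "poly_fun K d' q'" "\<forall>n t. same_gaps K t0 t \<longrightarrow> B n t = q' n t"
    using assms unfolding piecewise_poly_def by meson
  then show "\<exists>q. poly_fun K (d + d') q \<and> (\<forall>n t. same_gaps K t0 t \<longrightarrow> A n t * B n t = q n t)"
    by (intro exI[of _ "\<lambda>n t. q n t * q' n t"]) (auto intro: poly_fun_mult)
qed

text \<open>
  Needed because composing a permutation with an extensional tuple does not give an extensional
  tuple; only the entries in \<open>K\<close> are meaningful.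
\<close>

lemma piecewise_poly_cong:
  assumes "piecewise_poly K d A" "\<And>i. i \<in> K \<Longrightarrow> t i = t' i"
  shows "A n t = A n t'"
proof -
  obtain q where q: "poly_fun K d q" "\<And>s. same_gaps K t s \<Longrightarrow> A n s = q n s"
    using assms(1) unfolding piecewise_poly_def by meson
  have "same_gaps K t t'"
    using assms(2) by (auto simp: same_gaps_def)
  then have "A n t' = q n t'" "A n t = q n t"
    using q(2) same_gaps_refl by auto
  then show ?thesis using poly_fun_cong[OF q(1) assms(2)] by simp
qed

lemma piecewise_poly_reindex:
  assumes "piecewise_poly K d A" "inj_on h K" "h ` K \<subseteq> K'" "finite K'"
  shows "piecewise_poly K' d (\<lambda>n t. A n (\<lambda>i. t (h i)))"
  unfolding piecewise_poly_def
proof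
  fix t0
  obtain q where q: "poly_fun K d q" "\<And>n t. same_gaps K (\<lambda>i. t0 (h i)) t \<Longrightarrow> A n t = q n t"
    using assms(1) unfolding piecewise_poly_def by meson
  have "same_gaps K (\<lambda>i. t0 (h i)) (\<lambda>i. t (h i))" if "same_gaps K' t0 t" for t
    using that assms(3) by (auto simp: same_gaps_def)
  then show "\<exists>q. poly_fun K' d q \<and> (\<forall>n t. same_gaps K' t0 t \<longrightarrow> A n (\<lambda>i. t (h i)) = q n t)"
    using q poly_fun_reindex[OF q(1) assms(2-4)]
    by (intro exI[of _ "\<lambda>n t. q n (\<lambda>i. t (h i))"]) auto
qed

lemma sum_gap_class_piecewise_poly:
  assumes "piecewise_poly K d A" "finite K"
  shows "\<exists>p. degree p \<le> card K + d \<and>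
    (\<forall>n \<ge> card K. (\<Sum>t\<in>gap_class K t0 n. A n t) = poly p (of_nat n))"
proof -
  obtain q where q: "poly_fun K d q" "\<And>n t. same_gaps K t0 t \<Longrightarrow> A n t = q n t"
    using assms(1) unfolding piecewise_poly_def by meson
  have "\<exists>p. degree p \<le> card K + d \<and>
    (\<forall>n \<ge> card K. (\<Sum>t\<in>gap_class K t0 n. q n t) = poly p (of_nat n))"
    using q(1)
  proof induction
    case (monomial a e c)
    obtain p :: "rat poly" where p: "degree p \<le> card K + sum e K"
      "\<And>N. N \<ge> card K - 1 \<Longrightarrow> (\<Sum>t\<in>gap_class K t0 N. \<Prod>i\<in>K. of_nat (t i) ^ e i) = poly p (of_nat N)"
      using sum_gap_class_monomial_poly[OF assms(2), of e t0] by blast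
    have "degree (monom c a * p) \<le> card K + d"
      using degree_mult_le[of "monom c a" p] degree_monom_le[of c a] p(1) monomial by linarith
    then show ?case
      using p(2) by (intro exI[of _ "monom c a * p"]) (simp add: sum_distrib_left[symmetric] poly_monom)
  next
    case (add q q')
    then obtain p p' where "degree p \<le> card K + d" "degree p' \<le> card K + d"
      "\<forall>n \<ge> card K. (\<Sum>t\<in>gap_class K t0 n. q n t) = poly p (of_nat n)"
      "\<forall>n \<ge> card K. (\<Sum>t\<in>gap_class K t0 n. q' n t) = poly p' (of_nat n)" by blast
    then show ?case
      by (intro exI[of _ "p + p'"]) (simp add: sum.distrib degree_add_le)
  qed
  moreover have "(\<Sum>t\<in>gap_class K t0 n. A n t) = (\<Sum>t\<in>gap_class K t0 n. q n t)" for n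
    using q(2) by (intro sum.cong) (auto simp: gap_class_def)
  ultimately show ?thesis by simp
qed

section \<open>Permutations that carry one tuple to another\<close>

text \<open>
  If \<open>\<tau>0\<close> is one permutation of \<open>S\<close> that extends \<open>\<phi>\<close>, then the others are the compositions of \<open>\<tau>0\<close>
  with the permutations of \<open>S - X\<close>. For \<open>\<tau>0\<close>, complete \<open>\<phi>\<close> by any bijection between the
  complements of \<open>X\<close> and of its image.
\<close>

lemma card_permutations_extending:
  assumes "finite S" "X \<subseteq> S" "inj_on \<phi> X" "\<phi> ` X \<subseteq> S"
  shows "card {\<tau>. \<tau> permutes S \<and> (\<forall>x\<in>X. \<tau> x = \<phi> x)} = fact (card S - card X)"
proof -
  have fin: "finite X" using assms finite_subset by blast
  have "card (S - X) = card (S - \<phi> ` X)"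
    using assms fin by (simp add: card_Diff_subset card_image)
  then obtain g where g: "bij_betw g (S - X) (S - \<phi> ` X)"
    using assms(1) finite_same_card_bij[of "S - X" "S - \<phi> ` X"] by auto
  define \<tau>0 where "\<tau>0 x = (if x \<in> X then \<phi> x else if x \<in> S then g x else x)" for x
  have "bij_betw \<tau>0 (X \<union> (S - X)) (\<phi> ` X \<union> (S - \<phi> ` X))"
  proof (rule bij_betw_combine)
    show "bij_betw \<tau>0 X (\<phi> ` X)"
      using assms(3) by (auto simp: bij_betw_def inj_on_def \<tau>0_def)
    show "bij_betw \<tau>0 (S - X) (S - \<phi> ` X)"
      using g by (subst bij_betw_cong[of _ _ g]) (auto simp: \<tau>0_def)
  qed auto
  moreover have "X \<union> (S - X) = S" "\<phi> ` X \<union> (S - \<phi> ` X) = S" using assms by auto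
  ultimately have "bij_betw \<tau>0 S S" by simp
  then have \<tau>0: "\<tau>0 permutes S"
    using assms(2) by (intro bij_imp_permutes) (auto simp: \<tau>0_def)
  have "bij_betw (\<lambda>\<rho>. \<tau>0 \<circ> \<rho>) {\<rho>. \<rho> permutes (S - X)} {\<tau>. \<tau> permutes S \<and> (\<forall>x\<in>X. \<tau> x = \<phi> x)}"
  proof (rule bij_betw_byWitness[where f' = "\<lambda>\<tau>. inv \<tau>0 \<circ> \<tau>"])
    show "\<forall>\<rho>\<in>{\<rho>. \<rho> permutes (S - X)}. inv \<tau>0 \<circ> (\<tau>0 \<circ> \<rho>) = \<rho>"
      using permutes_inv_o(2)[OF \<tau>0] by (simp add: comp_assoc[symmetric])
    show "\<forall>\<tau>\<in>{\<tau>. \<tau> permutes S \<and> (\<forall>x\<in>X. \<tau> x = \<phi> x)}. \<tau>0 \<circ> (inv \<tau>0 \<circ> \<tau>) = \<tau>"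
      using permutes_inv_o(1)[OF \<tau>0] by (simp add: comp_assoc[symmetric])
    show "(\<lambda>\<rho>. \<tau>0 \<circ> \<rho>) ` {\<rho>. \<rho> permutes (S - X)} \<subseteq> {\<tau>. \<tau> permutes S \<and> (\<forall>x\<in>X. \<tau> x = \<phi> x)}"
    proof safe
      fix \<rho> assume \<rho>: "\<rho> permutes (S - X)"
      show "\<tau>0 \<circ> \<rho> permutes S"
        using permutes_subset[OF \<rho>, of S] \<tau>0 by (intro permutes_compose) auto
      fix x assume "x \<in> X"
      then show "(\<tau>0 \<circ> \<rho>) x = \<phi> x"
        using permutes_not_in[OF \<rho>, of x] by (simp add: \<tau>0_def)
    qed
    show "(\<lambda>\<tau>. inv \<tau>0 \<circ> \<tau>) ` {\<tau>. \<tau> permutes S \<and> (\<forall>x\<in>X. \<tau> x = \<phi> x)} \<subseteq> {\<rho>. \<rho> permutes (S - X)}"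
    proof safe
      fix \<tau> assume \<tau>: "\<tau> permutes S" "\<forall>x\<in>X. \<tau> x = \<phi> x"
      have "(inv \<tau>0 \<circ> \<tau>) permutes S"
        using \<tau>(1) permutes_inv[OF \<tau>0] by (rule permutes_compose)
      moreover have "(inv \<tau>0 \<circ> \<tau>) x = x" if "x \<in> X" for x
      proof -
        have "\<tau> x = \<tau>0 x" using \<tau>(2) that by (simp add: \<tau>0_def)
        then show ?thesis using permutes_inverses(2)[OF \<tau>0] by simp
      qed
      ultimately show "(inv \<tau>0 \<circ> \<tau>) permutes (S - X)"
        by (rule permutes_superset) auto
    qed
  qed
  then have "card {\<tau>. \<tau> permutes S \<and> (\<forall>x\<in>X. \<tau> x = \<phi> x)} = card {\<rho>. \<rho> permutes (S - X)}"
    by (rule bij_betw_same_card[symmetric])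
  also have "\<dots> = fact (card S - card X)"
    using assms fin by (simp add: card_permutations card_Diff_subset)
  finally show ?thesis .
qed

text \<open>
  A permutation with \<open>\<tau> (t i) = w i\<close> can exist only if \<open>t\<close> and \<open>w\<close> have the same coincidences. In that
  case \<open>t i \<mapsto> w i\<close> is a well-defined injective map on the entries of \<open>t\<close>.
\<close>

lemma card_permutations_moving_tuple:
  assumes t: "t \<in> K \<rightarrow> {1..n}" and w: "w \<in> K \<rightarrow> {1..n}"
  shows "card {\<tau>. \<tau> permutes {1..n} \<and> (\<forall>i\<in>K. \<tau> (t i) = w i)}
    = (if \<forall>i\<in>K. \<forall>j\<in>K. t i = t j \<longleftrightarrow> w i = w j then fact (n - card (t ` K)) else 0)"
proof (cases "\<forall>i\<in>K. \<forall>j\<in>K. t i = t j \<longleftrightarrow> w i = w j")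
  case True
  define \<phi> where "\<phi> x = w (inv_into K t x)" for x
  have \<phi>: "\<phi> (t i) = w i" if "i \<in> K" for i
  proof -
    have "t (inv_into K t (t i)) = t i" "inv_into K t (t i) \<in> K"
      using that by (simp_all add: f_inv_into_f inv_into_into)
    then show ?thesis using True that by (auto simp: \<phi>_def)
  qed
  have "{\<tau>. \<tau> permutes {1..n} \<and> (\<forall>i\<in>K. \<tau> (t i) = w i)}
      = {\<tau>. \<tau> permutes {1..n} \<and> (\<forall>x\<in>t ` K. \<tau> x = \<phi> x)}"
    using \<phi> by auto
  also have "card \<dots> = fact (card {1..n} - card (t ` K))"
    using assms True \<phi> by (intro card_permutations_extending) (auto simp: inj_on_def)
  finally show ?thesis using True by simp
next
  case False
  have "\<not> (\<tau> permutes {1..n} \<and> (\<forall>i\<in>K. \<tau> (t i) = w i))" for \<tau>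
    using False permutes_inj[of \<tau> "{1..n}"] by (metis injD)
  then have none: "{\<tau>. \<tau> permutes {1..n} \<and> (\<forall>i\<in>K. \<tau> (t i) = w i)} = {}" by blast
  show ?thesis unfolding if_not_P[OF False] none by simp
qed

text \<open>
  There are only finitely many tables of truncated gaps, and \<open>R\<close> contains one representative for each
  table that is realised by some tuple. It is essential that \<open>R\<close> does not depend on \<open>n\<close>: the
  polynomials that make up an aggregate must be the same for all \<open>n\<close>.
\<close>

lemma sum_over_gap_classes:
  assumes K: "finite K"
  obtains R where "finite R"
    "\<And>n (h :: (nat \<Rightarrow> nat) \<Rightarrow> rat). (\<Sum>t\<in>K \<rightarrow>\<^sub>E {1..n}. h t) = (\<Sum>t0\<in>R. \<Sum>t\<in>gap_class K t0 n. h t)"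
proof -
  define gap where "gap t = restrict (\<lambda>i. restrict (\<lambda>j. min 2 (t j - t i)) K) K" for t :: "nat \<Rightarrow> nat"
  have gap: "gap t = gap t0 \<longleftrightarrow> same_gaps K t0 t" for t t0
  proof
    assume eq: "gap t = gap t0"
    show "same_gaps K t0 t"
      unfolding same_gaps_def
    proof (intro ballI)
      fix i j assume "i \<in> K" "j \<in> K"
      then have "gap s i j = min 2 (s j - s i)" for s
        by (simp add: gap_def)
      then show "min 2 (t j - t i) = min 2 (t0 j - t0 i)"
        using eq by metis
    qed
  next
    assume "same_gaps K t0 t"
    then show "gap t = gap t0"
      unfolding gap_def by (intro restrict_ext) (simp add: same_gaps_def)
  qed
  have "range gap \<subseteq> K \<rightarrow>\<^sub>E (K \<rightarrow>\<^sub>E {0..2})"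
    by (auto simp: gap_def)
  then have fin: "finite (range gap)"
    by (rule finite_subset) (intro finite_PiE K finite_atLeastAtMost)
  define rep where "rep = inv_into UNIV gap"
  have rep: "gap (rep \<delta>) = \<delta>" if "\<delta> \<in> range gap" for \<delta>
    using that by (simp add: rep_def f_inv_into_f)
  have "(\<Sum>t\<in>K \<rightarrow>\<^sub>E {1..n}. h t) = (\<Sum>t0\<in>rep ` range gap. \<Sum>t\<in>gap_class K t0 n. h t)"
    for n and h :: "(nat \<Rightarrow> nat) \<Rightarrow> rat"
  proof -
    have "inj_on rep (range gap)"
      using rep by (metis inj_onI)
    then have "(\<Sum>t0\<in>rep ` range gap. \<Sum>t\<in>gap_class K t0 n. h t)
        = (\<Sum>\<delta>\<in>range gap. \<Sum>t\<in>gap_class K (rep \<delta>) n. h t)"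
      by (simp add: sum.reindex)
    also have "\<dots> = (\<Sum>\<delta>\<in>range gap. \<Sum>t\<in>{t \<in> K \<rightarrow>\<^sub>E {1..n}. gap t = \<delta>}. h t)"
    proof (intro sum.cong refl)
      fix \<delta> assume "\<delta> \<in> range gap"
      then show "gap_class K (rep \<delta>) n = {t \<in> K \<rightarrow>\<^sub>E {1..n}. gap t = \<delta>}"
        using rep[of \<delta>] gap[of _ "rep \<delta>"] by (auto simp: gap_class_def)
    qed
    also have "\<dots> = (\<Sum>t\<in>K \<rightarrow>\<^sub>E {1..n}. h t)"
      using fin K by (intro sum.group finite_PiE) auto
    finally show ?thesis ..
  qed
  then show ?thesis using fin that by blast
qed

section \<open>Decoupled functions and their aggregates\<close>

text \<open>
  Functions of a permutation whose dependence on values (through \<open>A\<close>) and on positions (through \<open>B\<close>)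
  is separated within each tuple sum. Simple statistics have this form, with the same degree, and in
  contrast to them the form does not refer to a pattern: the sum is over all tuples, also over those
  with repeated entries. This is what makes products easy.
\<close>

inductive decoupled :: "nat \<Rightarrow> perm_fun \<Rightarrow> bool" for m where
  tuple_sum: "piecewise_poly {1..k} d A \<Longrightarrow> piecewise_poly {1..k} d' B \<Longrightarrow> 2 * k + d + d' \<le> m \<Longrightarrow>
     (\<And>n \<sigma>. \<sigma> permutes {1..n} \<Longrightarrow>
        g n \<sigma> = (\<Sum>t\<in>{1..k} \<rightarrow>\<^sub>E {1..n}. A n t * B n (\<lambda>i. inv \<sigma> (t i)))) \<Longrightarrow>
     decoupled m g"
| add: "decoupled m g1 \<Longrightarrow> decoupled m g2 \<Longrightarrow>
     (\<And>n \<sigma>. \<sigma> permutes {1..n} \<Longrightarrow> g n \<sigma> = g1 n \<sigma> + g2 n \<sigma>) \<Longrightarrow> decoupled m g"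

text \<open>
  Substitute \<open>\<tau>\<close> for \<open>\<sigma>\<^sup>-\<^sup>1\<close>, exchange the sums and, for fixed \<open>t\<close>, collect the permutations \<open>\<tau>\<close>
  according to the tuple \<open>w = \<tau> \<circ> t\<close>. The summand depends on \<open>\<tau>\<close> through \<open>w\<close> only, so it is
  multiplied by the number of \<open>\<tau>\<close> that carry \<open>t\<close> to \<open>w\<close>.
\<close>

lemma aggregate_tuple_sum:
  assumes g: "\<And>\<sigma>. \<sigma> permutes {1..n} \<Longrightarrow> g n \<sigma> = (\<Sum>t\<in>K \<rightarrow>\<^sub>E {1..n}. A n t * B n (\<lambda>i. inv \<sigma> (t i)))"
    and B: "piecewise_poly K d B" and K: "finite K"
  shows "aggregate g n = (\<Sum>t\<in>K \<rightarrow>\<^sub>E {1..n}. \<Sum>w\<in>K \<rightarrow>\<^sub>E {1..n}. A n t * B n w *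
    (if \<forall>i\<in>K. \<forall>j\<in>K. t i = t j \<longleftrightarrow> w i = w j then fact (n - card (t ` K)) else 0))"
proof -
  define Perms where "Perms = {\<tau>. \<tau> permutes {1..n}}"
  have finP: "finite Perms" by (simp add: Perms_def finite_permutations)
  have finT: "finite (K \<rightarrow>\<^sub>E {1..n})" using K by (intro finite_PiE) auto
  have "aggregate g n = (\<Sum>\<sigma>\<in>Perms. \<Sum>t\<in>K \<rightarrow>\<^sub>E {1..n}. A n t * B n (\<lambda>i. inv \<sigma> (t i)))"
    unfolding aggregate_def Perms_def by (intro sum.cong) (auto simp: g)
  also have "\<dots> = (\<Sum>\<tau>\<in>Perms. \<Sum>t\<in>K \<rightarrow>\<^sub>E {1..n}. A n t * B n (\<lambda>i. \<tau> (t i)))"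
    unfolding Perms_def
    by (rule sum_permutations_inverse[of "\<lambda>\<tau>. \<Sum>t\<in>K \<rightarrow>\<^sub>E {1..n}. A n t * B n (\<lambda>i. \<tau> (t i))", symmetric])
  also have "\<dots> = (\<Sum>t\<in>K \<rightarrow>\<^sub>E {1..n}. \<Sum>\<tau>\<in>Perms. A n t * B n (\<lambda>i. \<tau> (t i)))"
    by (rule sum.swap)
  also have "\<dots> = (\<Sum>t\<in>K \<rightarrow>\<^sub>E {1..n}. \<Sum>w\<in>K \<rightarrow>\<^sub>E {1..n}. A n t * B n w *
    (if \<forall>i\<in>K. \<forall>j\<in>K. t i = t j \<longleftrightarrow> w i = w j then fact (n - card (t ` K)) else 0))"
  proof (rule sum.cong[OF refl])
    fix t assume t: "t \<in> K \<rightarrow>\<^sub>E {1..n}"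
    define img where "img \<tau> = restrict (\<lambda>i. \<tau> (t i)) K" for \<tau> :: "nat \<Rightarrow> nat"
    have "img ` Perms \<subseteq> K \<rightarrow>\<^sub>E {1..n}"
    proof (intro image_subsetI PiE_I)
      fix \<tau> i assume "\<tau> \<in> Perms" "i \<in> K"
      then show "img \<tau> i \<in> {1..n}"
        using t permutes_in_image[of \<tau> "{1..n}" "t i"] by (auto simp: img_def Perms_def)
    qed (simp add: img_def)
    then have "(\<Sum>\<tau>\<in>Perms. A n t * B n (\<lambda>i. \<tau> (t i)))
        = (\<Sum>w\<in>K \<rightarrow>\<^sub>E {1..n}. \<Sum>\<tau>\<in>{\<tau> \<in> Perms. img \<tau> = w}. A n t * B n (\<lambda>i. \<tau> (t i)))"
      by (rule sum.group[OF finP finT, symmetric])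
    also have "\<dots> = (\<Sum>w\<in>K \<rightarrow>\<^sub>E {1..n}. A n t * B n w *
        (if \<forall>i\<in>K. \<forall>j\<in>K. t i = t j \<longleftrightarrow> w i = w j then fact (n - card (t ` K)) else 0))"
    proof (rule sum.cong[OF refl])
      fix w assume w: "w \<in> K \<rightarrow>\<^sub>E {1..n}"
      have eq: "{\<tau> \<in> Perms. img \<tau> = w} = {\<tau>. \<tau> permutes {1..n} \<and> (\<forall>i\<in>K. \<tau> (t i) = w i)}"
        using w by (auto simp: Perms_def img_def PiE_def extensional_def fun_eq_iff)
      have "(\<Sum>\<tau>\<in>{\<tau> \<in> Perms. img \<tau> = w}. A n t * B n (\<lambda>i. \<tau> (t i)))
          = (\<Sum>\<tau>\<in>{\<tau> \<in> Perms. img \<tau> = w}. A n t * B n w)"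
      proof (intro sum.cong refl)
        fix \<tau> assume "\<tau> \<in> {\<tau> \<in> Perms. img \<tau> = w}"
        then have "\<tau> (t i) = w i" if "i \<in> K" for i
          using that unfolding eq by blast
        then show "A n t * B n (\<lambda>i. \<tau> (t i)) = A n t * B n w"
          using piecewise_poly_cong[OF B, of "\<lambda>i. \<tau> (t i)" w] by simp
      qed
      also have "\<dots> = A n t * B n w * of_nat (card {\<tau> \<in> Perms. img \<tau> = w})"
        by (simp add: mult.commute)
      also have "card {\<tau> \<in> Perms. img \<tau> = w}
          = (if \<forall>i\<in>K. \<forall>j\<in>K. t i = t j \<longleftrightarrow> w i = w j then fact (n - card (t ` K)) else 0)"
        unfolding eq using t w by (intro card_permutations_moving_tuple) (auto simp: PiE_def)
      finally show "(\<Sum>\<tau>\<in>{\<tau> \<in> Perms. img \<tau> = w}. A n t * B n (\<lambda>i. \<tau> (t i))) = A n t * B n w *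
          (if \<forall>i\<in>K. \<forall>j\<in>K. t i = t j \<longleftrightarrow> w i = w j then fact (n - card (t ` K)) else 0)"
        by simp
    qed
    finally show "(\<Sum>\<tau>\<in>Perms. A n t * B n (\<lambda>i. \<tau> (t i))) = (\<Sum>w\<in>K \<rightarrow>\<^sub>E {1..n}. A n t * B n w *
        (if \<forall>i\<in>K. \<forall>j\<in>K. t i = t j \<longleftrightarrow> w i = w j then fact (n - card (t ` K)) else 0))" .
  qed
  finally show ?thesis .
qed

lemma same_gaps_card_image:
  assumes "same_gaps K t0 t"
  shows "card (t ` K) = card (t0 ` K)"
proof -
  define \<phi> where "\<phi> x = t (inv_into K t0 x)" for x
  have \<phi>: "\<phi> (t0 i) = t i" if "i \<in> K" for i
    using same_gapsD(2)[OF assms] that by (simp add: \<phi>_def f_inv_into_f inv_into_into)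
  then have "t ` K = \<phi> ` (t0 ` K)" by (simp add: image_image)
  moreover have "inj_on \<phi> (t0 ` K)"
    using \<phi> same_gapsD(2)[OF assms] by (auto simp: inj_on_def)
  ultimately show ?thesis by (simp add: card_image)
qed

text \<open>
  The number of permutations that carry \<open>t\<close> to \<open>w\<close> depends only on the gap classes of \<open>t\<close> and \<open>w\<close>.
  On a pair of gap classes the double sum therefore factors, as in \<open>part\<close> below, into two polynomials
  in \<open>n\<close> and a factorial.
\<close>

lemma aggregate_decoupled:
  assumes "decoupled m g"
  shows "factorial_comb m (aggregate g)"
  using assms
proof induction
  case (tuple_sum k d A d' B g)
  define K where "K = {1..k}"
  have K: "finite K" "card K = k" by (simp_all add: K_def)
  have PA: "piecewise_poly K d A" and PB: "piecewise_poly K d' B" and m: "2 * k + d + d' \<le> m"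
    using tuple_sum by (simp_all add: K_def)
  define ker where "ker t w \<longleftrightarrow> (\<forall>i\<in>K. \<forall>j\<in>K. t i = t j \<longleftrightarrow> w i = w j)" for t w :: "nat \<Rightarrow> nat"
  obtain R where R: "finite R"
    "\<And>n (h :: (nat \<Rightarrow> nat) \<Rightarrow> rat). (\<Sum>t\<in>K \<rightarrow>\<^sub>E {1..n}. h t) = (\<Sum>t0\<in>R. \<Sum>t\<in>gap_class K t0 n. h t)"
    using sum_over_gap_classes[OF K(1)] by blast
  define part where "part t0 w0 n = (\<Sum>t\<in>gap_class K t0 n. A n t) * (\<Sum>w\<in>gap_class K w0 n. B n w) *
    (if ker t0 w0 then fact (n - card (t0 ` K)) else 0)" for t0 w0 n
  have agg: "aggregate g n = (\<Sum>t0\<in>R. \<Sum>w0\<in>R. part t0 w0 n)" for n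
  proof -
    have "aggregate g n = (\<Sum>t\<in>K \<rightarrow>\<^sub>E {1..n}. \<Sum>w\<in>K \<rightarrow>\<^sub>E {1..n}. A n t * B n w *
        (if ker t w then fact (n - card (t ` K)) else 0))"
      unfolding ker_def using tuple_sum(4)
      by (intro aggregate_tuple_sum[OF _ PB K(1)]) (simp add: K_def)
    also have "\<dots> = (\<Sum>t0\<in>R. \<Sum>t\<in>gap_class K t0 n. \<Sum>w0\<in>R. \<Sum>w\<in>gap_class K w0 n. A n t * B n w *
        (if ker t w then fact (n - card (t ` K)) else 0))"
      unfolding R(2) ..
    also have "\<dots> = (\<Sum>t0\<in>R. \<Sum>w0\<in>R. \<Sum>t\<in>gap_class K t0 n. \<Sum>w\<in>gap_class K w0 n. A n t * B n w *
        (if ker t w then fact (n - card (t ` K)) else 0))"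
      by (intro sum.cong refl sum.swap)
    also have "\<dots> = (\<Sum>t0\<in>R. \<Sum>w0\<in>R. part t0 w0 n)"
    proof (intro sum.cong refl)
      fix t0 w0
      have "(\<Sum>t\<in>gap_class K t0 n. \<Sum>w\<in>gap_class K w0 n. A n t * B n w *
          (if ker t w then fact (n - card (t ` K)) else 0))
        = (\<Sum>t\<in>gap_class K t0 n. \<Sum>w\<in>gap_class K w0 n. A n t * B n w *
          (if ker t0 w0 then fact (n - card (t0 ` K)) else 0))"
      proof (intro sum.cong refl)
        fix t w assume "t \<in> gap_class K t0 n" "w \<in> gap_class K w0 n"
        then have "same_gaps K t0 t" "same_gaps K w0 w" by (auto simp: gap_class_def)
        moreover from this have "ker t w \<longleftrightarrow> ker t0 w0"
          unfolding ker_def by (simp add: same_gapsD(2))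
        ultimately show "A n t * B n w * (if ker t w then fact (n - card (t ` K)) else 0)
          = A n t * B n w * (if ker t0 w0 then fact (n - card (t0 ` K)) else 0)"
          using same_gaps_card_image by simp
      qed
      also have "\<dots> = part t0 w0 n"
        unfolding part_def by (subst sum_product) (simp only: sum_distrib_right)
      finally show "(\<Sum>t\<in>gap_class K t0 n. \<Sum>w\<in>gap_class K w0 n. A n t * B n w *
          (if ker t w then fact (n - card (t ` K)) else 0)) = part t0 w0 n" .
    qed
    finally show ?thesis .
  qed
  have "factorial_comb m (part t0 w0)" for t0 w0
  proof -
    obtain p where p: "degree p \<le> k + d" "\<And>n. n \<ge> k \<Longrightarrow> (\<Sum>t\<in>gap_class K t0 n. A n t) = poly p (of_nat n)"
      using sum_gap_class_piecewise_poly[OF PA K(1), of t0] unfolding K(2) by blast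
    obtain q where q: "degree q \<le> k + d'" "\<And>n. n \<ge> k \<Longrightarrow> (\<Sum>w\<in>gap_class K w0 n. B n w) = poly q (of_nat n)"
      using sum_gap_class_piecewise_poly[OF PB K(1), of w0] unfolding K(2) by blast
    have deg: "degree (p * q) \<le> m"
      using degree_mult_le[of p q] p(1) q(1) m by linarith
    have km: "k \<le> m div 2" using m by linarith
    show ?thesis
    proof (cases "ker t0 w0")
      case True
      have "card (t0 ` K) \<le> m div 2"
        using card_image_le[OF K(1), of t0] K(2) km by linarith
      from factorial_comb_poly_times_fact[OF deg this] show ?thesis
        by (rule factorial_comb_cong) (use km True in \<open>simp add: part_def p(2) q(2)\<close>)
    next
      case False
      then show ?thesis
        using factorial_comb_0[of m] by (rule_tac factorial_comb_cong) (auto simp: part_def)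
    qed
  qed
  then have "factorial_comb m (\<lambda>n. \<Sum>t0\<in>R. \<Sum>w0\<in>R. part t0 w0 n)"
    by (intro factorial_comb_sum R(1))
  then show ?case
    by (rule factorial_comb_cong) (rule agg)
next
  case (add g1 g2 g)
  have "aggregate g n = aggregate g1 n + aggregate g2 n" for n
    unfolding aggregate_def sum.distrib[symmetric] by (intro sum.cong) (auto simp: add.hyps)
  then show ?case
    using factorial_comb_add[OF add.IH] by (rule_tac factorial_comb_cong) auto
qed

lemma sum_PiE_concat:
  fixes F :: "(nat \<Rightarrow> nat) \<Rightarrow> rat"
  assumes F: "\<And>t t'. (\<And>i. i \<in> {1..k} \<Longrightarrow> t i = t' i) \<Longrightarrow> F t = F t'"
    and G: "\<And>t t'. (\<And>i. i \<in> {1..l} \<Longrightarrow> t i = t' i) \<Longrightarrow> G t = G t'"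
  shows "(\<Sum>t\<in>{1..k} \<rightarrow>\<^sub>E X. F t) * (\<Sum>t\<in>{1..l} \<rightarrow>\<^sub>E X. G t)
    = (\<Sum>t\<in>{1..k + l} \<rightarrow>\<^sub>E X. F t * G (\<lambda>i. t (k + i)))"
proof -
  define cat where "cat = (\<lambda>(s, u) i. if i \<le> k then s i else (u (i - k) :: nat))"
  define uncat where "uncat t = (restrict t {1..k}, restrict (\<lambda>i. t (k + i)) {1..l})" for t :: "nat \<Rightarrow> nat"
  have "(\<Sum>t\<in>{1..k} \<rightarrow>\<^sub>E X. F t) * (\<Sum>t\<in>{1..l} \<rightarrow>\<^sub>E X. G t)
      = (\<Sum>(s, u)\<in>({1..k} \<rightarrow>\<^sub>E X) \<times> ({1..l} \<rightarrow>\<^sub>E X). F s * G u)"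
    by (simp add: sum_product sum.cartesian_product)
  also have "\<dots> = (\<Sum>t\<in>{1..k + l} \<rightarrow>\<^sub>E X. F t * G (\<lambda>i. t (k + i)))"
  proof (rule sum.reindex_bij_witness[where i = uncat and j = cat])
    fix a assume "a \<in> ({1..k} \<rightarrow>\<^sub>E X) \<times> ({1..l} \<rightarrow>\<^sub>E X)"
    then obtain s u where a: "a = (s, u)" and s: "s \<in> {1..k} \<rightarrow>\<^sub>E X" and u: "u \<in> {1..l} \<rightarrow>\<^sub>E X" by blast
    show "uncat (cat a) = a"
      using s u by (auto simp: a cat_def uncat_def fun_eq_iff PiE_def extensional_def)
    show "cat a \<in> {1..k + l} \<rightarrow>\<^sub>E X"
    proof
      fix i assume i: "i \<in> {1..k + l}"
      show "cat a i \<in> X"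
      proof (cases "i \<le> k")
        case True
        then show ?thesis using s i by (auto simp: a cat_def)
      next
        case False
        then have "i - k \<in> {1..l}" using i by auto
        then show ?thesis using u False by (auto simp: a cat_def)
      qed
    next
      fix i assume i: "i \<notin> {1..k + l}"
      show "cat a i = undefined"
      proof (cases "i \<le> k")
        case True
        then show ?thesis using s i by (auto simp: a cat_def PiE_def extensional_def)
      next
        case False
        then have "i - k \<notin> {1..l}" using i by auto
        then show ?thesis using u False by (auto simp: a cat_def PiE_def extensional_def)
      qed
    qed
    have "F (cat a) = F s" by (rule F) (simp add: a cat_def)
    moreover have "G (\<lambda>i. cat a (k + i)) = G u" by (rule G) (simp add: a cat_def)
    ultimately show "F (cat a) * G (\<lambda>i. cat a (k + i)) = (case a of (s, u) \<Rightarrow> F s * G u)"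
      by (simp add: a)
  next
    fix t assume t: "t \<in> {1..k + l} \<rightarrow>\<^sub>E X"
    show "cat (uncat t) = t"
      using t by (auto simp: cat_def uncat_def fun_eq_iff PiE_def extensional_def)
    show "uncat t \<in> ({1..k} \<rightarrow>\<^sub>E X) \<times> ({1..l} \<rightarrow>\<^sub>E X)"
      using t by (auto simp: uncat_def PiE_def Pi_def)
  qed
  finally show ?thesis .
qed

section \<open>Products of decoupled functions\<close>

text \<open>
  A pair consisting of a \<open>k\<close>-tuple and an \<open>l\<close>-tuple is a \<open>(k + l)\<close>-tuple, with no condition relating the
  two parts. The piecewise polynomials of the factors stay piecewise polynomial on the longer tuple,
  as its gap class determines those of both parts.
\<close>

lemma decoupled_mult:
  fixes f g h :: perm_fun
  assumes "decoupled m g" "decoupled m' h"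
    and "\<And>n \<sigma>. \<sigma> permutes {1..n} \<Longrightarrow> f n \<sigma> = g n \<sigma> * h n \<sigma>"
  shows "decoupled (m + m') f"
  using assms(1,3)
proof (induction arbitrary: f)
  case (tuple_sum k d A d' B g)
  note g = tuple_sum
  show ?case
    using assms(2) g(5)
  proof (induction arbitrary: f)
    case (tuple_sum l e A' e' B' h)
    note h = tuple_sum
    have concat: "piecewise_poly {1..k + l} (c + c') (\<lambda>n t. F n t * F' n (\<lambda>i. t (k + i)))"
      if "piecewise_poly {1..k} c F" "piecewise_poly {1..l} c' F'" for c c' F F'
    proof (rule piecewise_poly_mult)
      show "piecewise_poly {1..k + l} c F"
        using piecewise_poly_reindex[OF that(1), of "\<lambda>i. i" "{1..k + l}"] by simp
      show "piecewise_poly {1..k + l} c' (\<lambda>n t. F' n (\<lambda>i. t (k + i)))"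
        by (rule piecewise_poly_reindex[OF that(2)]) auto
    qed
    show ?case
    proof (rule decoupled.tuple_sum[OF concat[OF g(1) h(1)] concat[OF g(2) h(2)]])
      show "2 * (k + l) + (d + e) + (d' + e') \<le> m + m'"
        using g(3) h(3) by simp
      fix n :: nat and \<sigma> assume \<sigma>: "\<sigma> permutes {1..n}"
      have "f n \<sigma> = (\<Sum>t\<in>{1..k} \<rightarrow>\<^sub>E {1..n}. A n t * B n (\<lambda>i. inv \<sigma> (t i))) *
        (\<Sum>t\<in>{1..l} \<rightarrow>\<^sub>E {1..n}. A' n t * B' n (\<lambda>i. inv \<sigma> (t i)))"
        using h(5)[OF \<sigma>] g(4)[OF \<sigma>] h(4)[OF \<sigma>] by simp
      also have "\<dots> = (\<Sum>t\<in>{1..k + l} \<rightarrow>\<^sub>E {1..n}. (A n t * B n (\<lambda>i. inv \<sigma> (t i))) *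
          (A' n (\<lambda>i. t (k + i)) * B' n (\<lambda>i. inv \<sigma> (t (k + i)))))"
      proof (rule sum_PiE_concat)
        show "A n t * B n (\<lambda>i. inv \<sigma> (t i)) = A n t' * B n (\<lambda>i. inv \<sigma> (t' i))"
          if "\<And>i. i \<in> {1..k} \<Longrightarrow> t i = t' i" for t t'
          using piecewise_poly_cong[OF g(1) that]
            piecewise_poly_cong[OF g(2), of "\<lambda>i. inv \<sigma> (t i)" "\<lambda>i. inv \<sigma> (t' i)"] that by simp
        show "A' n t * B' n (\<lambda>i. inv \<sigma> (t i)) = A' n t' * B' n (\<lambda>i. inv \<sigma> (t' i))"
          if "\<And>i. i \<in> {1..l} \<Longrightarrow> t i = t' i" for t t'
          using piecewise_poly_cong[OF h(1) that]
            piecewise_poly_cong[OF h(2), of "\<lambda>i. inv \<sigma> (t i)" "\<lambda>i. inv \<sigma> (t' i)"] that by simp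
      qed
      finally show "f n \<sigma> = (\<Sum>t\<in>{1..k + l} \<rightarrow>\<^sub>E {1..n}. A n t * A' n (\<lambda>i. t (k + i)) *
          (B n (\<lambda>i. inv \<sigma> (t i)) * B' n (\<lambda>i. inv \<sigma> (t (k + i)))))"
        by (simp add: mult_ac)
    qed
  next
    case (add h1 h2 h)
    show ?case
      by (rule decoupled.add[OF add.IH(1)[of "\<lambda>n \<sigma>. g n \<sigma> * h1 n \<sigma>"] add.IH(2)[of "\<lambda>n \<sigma>. g n \<sigma> * h2 n \<sigma>"]])
         (simp_all add: add.hyps add.prems distrib_left)
  qed
next
  case (add g1 g2 g)
  show ?case
    by (rule decoupled.add[OF add.IH(1)[of "\<lambda>n \<sigma>. g1 n \<sigma> * h n \<sigma>"] add.IH(2)[of "\<lambda>n \<sigma>. g2 n \<sigma> * h n \<sigma>"]])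
       (simp_all add: add.hyps add.prems distrib_right)
qed

lemma decoupled_const:
  assumes "\<And>n \<sigma>. \<sigma> permutes {1..n} \<Longrightarrow> f n \<sigma> = c"
  shows "decoupled m f"
  \<comment> \<open>There is exactly one tuple of length \<open>0\<close>.\<close>
proof (rule decoupled.tuple_sum[where k = 0 and d = 0 and d' = 0 and A = "\<lambda>_ _. c" and B = "\<lambda>_ _. 1"])
qed (simp_all add: assms piecewise_poly_of_poly_fun poly_fun_const)

lemma decoupled_power:
  assumes "decoupled m f"
  shows "decoupled (m * r) (\<lambda>n \<sigma>. f n \<sigma> ^ r)"
proof (induction r)
  case 0
  show ?case by (rule decoupled_const[of _ 1]) simp
next
  case (Suc r)
  show ?case using decoupled_mult[OF assms Suc] by simp
qed

section \<open>Statistics are decoupled\<close>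

text \<open>
  Variable \<open>0\<close> is evaluated at \<open>n\<close>, so its exponent becomes the power of \<open>n\<close> in the monomial, and
  the total degrees agree.
\<close>

lemma poly_fun_eval_at:
  assumes "mpoly_vars Q \<subseteq> {0..k}"
  shows "poly_fun {1..k} (mpoly_degree Q) (\<lambda>n t. of_int (eval_at Q n t))"
proof -
  have "poly_fun {1..k} (mpoly_degree Q) (\<lambda>n t. of_int (Poly_Mapping.lookup Q \<mu>) *
      (\<Prod>i\<in>Poly_Mapping.keys \<mu>. of_int (if i = 0 then int n else int (t i)) ^ Poly_Mapping.lookup \<mu> i))"
    if \<mu>: "\<mu> \<in> Poly_Mapping.keys Q" for \<mu>
  proof -
    let ?e = "Poly_Mapping.lookup \<mu>"
    have sub: "Poly_Mapping.keys \<mu> \<subseteq> {0..k}"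
      using assms \<mu> by (auto simp: mpoly_vars_def)
    have ins: "{0..k} = insert 0 {1..k}" by auto
    have "?e 0 + sum ?e {1..k} = sum ?e {0..k}"
      unfolding ins by simp
    also have "\<dots> = sum ?e (Poly_Mapping.keys \<mu>)"
      using sub by (intro sum.mono_neutral_right) (auto simp: in_keys_iff)
    also have "\<dots> \<le> mpoly_degree Q"
      unfolding mpoly_degree_def using \<mu> by (intro Max_ge) auto
    finally have deg: "?e 0 + sum ?e {1..k} \<le> mpoly_degree Q" .
    have "(\<Prod>i\<in>Poly_Mapping.keys \<mu>. of_int (if i = 0 then int n else int (t i)) ^ ?e i :: rat)
        = of_nat n ^ ?e 0 * (\<Prod>i\<in>{1..k}. of_nat (t i) ^ ?e i)" for n and t :: "nat \<Rightarrow> nat"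
    proof -
      have "(\<Prod>i\<in>Poly_Mapping.keys \<mu>. of_int (if i = 0 then int n else int (t i)) ^ ?e i :: rat)
          = (\<Prod>i\<in>{0..k}. of_int (if i = 0 then int n else int (t i)) ^ ?e i)"
        using sub by (intro prod.mono_neutral_left) (auto simp: in_keys_iff)
      also have "\<dots> = of_nat n ^ ?e 0 * (\<Prod>i\<in>{1..k}. of_int (if i = 0 then int n else int (t i)) ^ ?e i)"
        unfolding ins by simp
      also have "(\<Prod>i\<in>{1..k}. of_int (if i = 0 then int n else int (t i)) ^ ?e i :: rat)
          = (\<Prod>i\<in>{1..k}. of_nat (t i) ^ ?e i)"
        by (intro prod.cong) auto
      finally show ?thesis .
    qed
    then show ?thesis
      using poly_fun.monomial[OF deg, of "of_int (Poly_Mapping.lookup Q \<mu>)"] by (simp add: mult.assoc)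
  qed
  from poly_fun_sum[OF finite_keys this] show ?thesis
    by (simp add: eval_at_def mpoly_eval_def)
qed

lemma prec_pairs_iff:
  assumes "\<sigma> permutes {1..n}" "u \<in> {1..n}" "v \<in> {1..n}"
  shows "(u, v) \<in> prec_pairs n \<sigma> \<longleftrightarrow> inv \<sigma> u < inv \<sigma> v"
proof
  assume "(u, v) \<in> prec_pairs n \<sigma>"
  then show "inv \<sigma> u < inv \<sigma> v"
    using permutes_inverses(2)[OF assms(1)] by (auto simp: prec_pairs_def)
next
  assume lt: "inv \<sigma> u < inv \<sigma> v"
  have "inv \<sigma> u \<in> {1..n}" "inv \<sigma> v \<in> {1..n}"
    using assms permutes_in_image[OF permutes_inv[OF assms(1)]] by blast+
  with lt show "(u, v) \<in> prec_pairs n \<sigma>"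
    unfolding prec_pairs_def using permutes_inverses(1)[OF assms(1)]
    by (intro CollectI exI[of _ "inv \<sigma> u"] exI[of _ "inv \<sigma> v"]) simp
qed

text \<open>
  Each of the conditions on an occurrence concerns either the values \<open>t\<close> alone or the positions
  \<open>\<sigma>\<^sup>-\<^sup>1 \<circ> t\<close> alone. In particular, \<open>(t i, t j)\<close> is in \<open>prec_pairs n \<sigma>\<close> exactly if the position of
  \<open>t i\<close> is smaller than that of \<open>t j\<close>. The indicators \<open>\<Phi>\<close> and \<open>\<Psi>\<close> of the two groups of conditions
  have degree \<open>0\<close>, so the degree of the tuple sum is that of the statistic.
\<close>

lemma decoupled_simple_stat:
  assumes "is_simple_stat S" "simple_stat_degree S \<le> m"
  shows "decoupled m (\<lambda>n \<sigma>. c * of_int (simple_stat_fun S n \<sigma>))"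
proof -
  define P where "P = st_pat S"
  define k where "k = pat_len P"
  define \<pi> where "\<pi> = pat_perm P"
  have \<pi>: "\<pi> permutes {1..k}" and C: "pat_C P \<subseteq> {1..<k}" and D: "pat_D P \<subseteq> {1..<k}"
    and vars: "mpoly_vars (st_Q1 S) \<subseteq> {0..k}" "mpoly_vars (st_Q2 S) \<subseteq> {0..k}"
    using assms(1) by (auto simp: is_simple_stat_def is_pattern_def P_def k_def \<pi>_def)
  define \<Phi> where "\<Phi> t \<longleftrightarrow> (\<forall>i\<in>{1..k}. \<forall>j\<in>{1..k}. i < j \<longrightarrow> t i < t j) \<and>
    (\<forall>i\<in>pat_D P. t (i + 1) = t i + 1)" for t :: "nat \<Rightarrow> nat"
  define \<Psi> where "\<Psi> s \<longleftrightarrow> (\<forall>i\<in>{1..k}. \<forall>j\<in>{1..k}. s i < s j \<longleftrightarrow> (i, j) \<in> prec_pairs k \<pi>) \<and>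
    (\<forall>i\<in>pat_C P. s (\<pi> (i + 1)) = s (\<pi> i) + 1)" for s :: "nat \<Rightarrow> nat"
  have Ppos: "piecewise_poly {1..k} 0 (\<lambda>n t. of_bool (\<Phi> t))"
  proof (rule piecewise_poly_indicator)
    fix t0 t assume g: "same_gaps {1..k} t0 t"
    have "t (i + 1) = t i + 1 \<longleftrightarrow> t0 (i + 1) = t0 i + 1" if "i \<in> pat_D P" for i
      using that D by (intro same_gapsD(3)[OF g]) auto
    then show "\<Phi> t \<longleftrightarrow> \<Phi> t0"
      unfolding \<Phi>_def using same_gapsD(1)[OF g] by (auto simp del: atLeastAtMost_iff)
  qed
  have Pval: "piecewise_poly {1..k} 0 (\<lambda>n t. of_bool (\<Psi> t))"
  proof (rule piecewise_poly_indicator)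
    fix t0 t assume g: "same_gaps {1..k} t0 t"
    have "t (\<pi> (i + 1)) = t (\<pi> i) + 1 \<longleftrightarrow> t0 (\<pi> (i + 1)) = t0 (\<pi> i) + 1" if "i \<in> pat_C P" for i
    proof (rule same_gapsD(3)[OF g])
      have "i \<in> {1..k}" "i + 1 \<in> {1..k}" using that C by auto
      then show "\<pi> i \<in> {1..k}" "\<pi> (i + 1) \<in> {1..k}"
        using permutes_in_image[OF \<pi>] by blast+
    qed
    then show "\<Psi> t \<longleftrightarrow> \<Psi> t0"
      unfolding \<Psi>_def using same_gapsD(1)[OF g] by (auto simp del: atLeastAtMost_iff)
  qed
  have PA: "piecewise_poly {1..k} (0 + mpoly_degree (st_Q1 S))
      (\<lambda>n t. of_bool (\<Phi> t) * of_int (eval_at (st_Q1 S) n t))"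
    by (intro piecewise_poly_mult Ppos piecewise_poly_of_poly_fun poly_fun_eval_at vars)
  have PA: "piecewise_poly {1..k} (0 + (0 + mpoly_degree (st_Q1 S)))
      (\<lambda>n t. c * (of_bool (\<Phi> t) * of_int (eval_at (st_Q1 S) n t)))"
    by (rule piecewise_poly_mult[OF piecewise_poly_of_poly_fun[OF poly_fun_const] PA])
  have PB: "piecewise_poly {1..k} (0 + mpoly_degree (st_Q2 S))
      (\<lambda>n t. of_bool (\<Psi> t) * of_int (eval_at (st_Q2 S) n t))"
    by (intro piecewise_poly_mult Pval piecewise_poly_of_poly_fun poly_fun_eval_at vars)
  show ?thesis
  proof (rule decoupled.tuple_sum[OF PA PB])
    show "2 * k + (0 + (0 + mpoly_degree (st_Q1 S))) + (0 + mpoly_degree (st_Q2 S)) \<le> m"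
      using assms(2) by (simp add: simple_stat_degree_def k_def P_def)
    fix n :: nat and \<sigma> assume \<sigma>: "\<sigma> permutes {1..n}"
    have occ: "occurrences P n \<sigma> = {t \<in> {1..k} \<rightarrow>\<^sub>E {1..n}. \<Phi> t \<and> \<Psi> (\<lambda>i. inv \<sigma> (t i))}"
    proof -
      have "(t i, t j) \<in> prec_pairs n \<sigma> \<longleftrightarrow> inv \<sigma> (t i) < inv \<sigma> (t j)"
        if "t \<in> {1..k} \<rightarrow>\<^sub>E {1..n}" "i \<in> {1..k}" "j \<in> {1..k}" for t i j
        using that by (intro prec_pairs_iff[OF \<sigma>]) blast+
      then show ?thesis
        unfolding occurrences_def \<Phi>_def \<Psi>_def k_def[symmetric] \<pi>_def[symmetric]
        by (auto simp del: atLeastAtMost_iff)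
    qed
    have "c * of_int (simple_stat_fun S n \<sigma>) = (\<Sum>t\<in>occurrences P n \<sigma>.
        c * (of_int (eval_at (st_Q1 S) n t) * of_int (eval_at (st_Q2 S) n (\<lambda>i. inv \<sigma> (t i)))))"
      by (simp add: simple_stat_fun_def P_def sum_distrib_left)
    also have "\<dots> = (\<Sum>t\<in>{1..k} \<rightarrow>\<^sub>E {1..n}. c * (of_bool (\<Phi> t) * of_int (eval_at (st_Q1 S) n t)) *
        (of_bool (\<Psi> (\<lambda>i. inv \<sigma> (t i))) * of_int (eval_at (st_Q2 S) n (\<lambda>i. inv \<sigma> (t i)))))"
      unfolding occ by (intro sum.mono_neutral_cong_left finite_PiE) auto
    finally show "c * of_int (simple_stat_fun S n \<sigma>) = \<dots>" .
  qed
qed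

lemma decoupled_represents:
  assumes "represents L f" "\<And>c S. (c, S) \<in> set L \<Longrightarrow> simple_stat_degree S \<le> m"
  shows "decoupled m f"
proof -
  have "decoupled m (\<lambda>n \<sigma>. \<Sum>(c, S)\<leftarrow>L. c * of_int (simple_stat_fun S n \<sigma>))"
    if "\<forall>(c, S)\<in>set L. is_simple_stat S \<and> simple_stat_degree S \<le> m" for L
    using that
  proof (induction L)
    case Nil
    show ?case by (rule decoupled_const[of _ 0]) simp
  next
    case (Cons x L)
    obtain c S where x: "x = (c, S)" by (cases x)
    have "decoupled m (\<lambda>n \<sigma>. c * of_int (simple_stat_fun S n \<sigma>))"
      using Cons.prems x by (intro decoupled_simple_stat) auto
    from decoupled.add[OF this Cons.IH] show ?case
      using Cons.prems by (simp add: x)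
  qed
  moreover have "\<forall>(c, S)\<in>set L. is_simple_stat S \<and> simple_stat_degree S \<le> m"
    using assms by (auto simp: represents_def)
  ultimately have L: "decoupled m (\<lambda>n \<sigma>. \<Sum>(c, S)\<leftarrow>L. c * of_int (simple_stat_fun S n \<sigma>))"
    by blast
  show ?thesis
    by (rule decoupled.add[OF L decoupled_const[of "\<lambda>_ _. 0" 0]])
       (use assms(1) in \<open>simp_all add: represents_def\<close>)
qed

section \<open>Aggregates of powers of statistics\<close>

theorem theorem4p5:
  fixes f :: perm_fun and m r :: nat
  assumes "is_statistic f"
    and "statistic_degree f = m"
    and "r > 0"
  shows "\<exists>(I::int) (J::int) (\<alpha>::int \<Rightarrow> rat).
           - of_int I \<ge> - (of_nat (r * m) / 2 :: rat) \<and>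
           J \<le> int (m * r) \<and>
           (\<forall>n::nat. int n \<ge> I \<longrightarrow>
              aggregate (\<lambda>n \<sigma>. f n \<sigma> ^ r) n =
                (\<Sum>i\<in>{-I..J}. \<alpha> i * fact (nat (int n + i))))"
proof -
  \<comment> \<open>The degree is a minimum, so some representation attains it; each of its terms has degree at most \<open>m\<close>.\<close>
  define attained where "attained d \<longleftrightarrow>
    (\<exists>L. represents L f \<and> d = Max ((\<lambda>(c, S). simple_stat_degree S) ` set L))" for d
  have "\<exists>d. attained d"
    using assms(1) by (auto simp: is_statistic_def attained_def)
  then have "attained (LEAST d. attained d)" by (rule LeastI_ex)
  moreover have "(LEAST d. attained d) = m"
    using assms(2) by (simp add: statistic_degree_def attained_def)
  ultimately obtain L where L: "represents L f" "m = Max ((\<lambda>(c, S). simple_stat_degree S) ` set L)"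
    by (auto simp: attained_def)
  have "simple_stat_degree S \<le> m" if "(c, S) \<in> set L" for c S
    unfolding L(2) using that by (intro Max_ge) force+
  then have "decoupled (m * r) (\<lambda>n \<sigma>. f n \<sigma> ^ r)"
    by (intro decoupled_power decoupled_represents[OF L(1)])
  from aggregate_decoupled[OF this] obtain \<alpha> where
    \<alpha>: "\<And>n. n \<ge> m * r div 2 \<Longrightarrow> aggregate (\<lambda>n \<sigma>. f n \<sigma> ^ r) n
      = (\<Sum>i\<in>{- int (m * r div 2)..int (m * r)}. \<alpha> i * fact (nat (int n + i)))"
    unfolding factorial_comb_def by blast
  have "(of_nat (m * r div 2) :: rat) * 2 \<le> of_nat (r * m)"
    by (metis div_times_less_eq_dividend mult.commute of_nat_le_iff of_nat_mult of_nat_numeral)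
  then have "- of_int (int (m * r div 2)) \<ge> - (of_nat (r * m) / 2 :: rat)"
    by simp
  with \<alpha> show ?thesis
    by (intro exI[of _ "int (m * r div 2)"] exI[of _ "int (m * r)"] exI[of _ \<alpha>]) simp
qed

end
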